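(* Let $K$ be a field and let $\psi\colon D\to E$ be a morphism of dialgebras over $K$. If the group $HY^2(\psi,\psi)$ is trivial, then $\psi$ is rigid.
   Context: **Dialgebras.** All tensor products and $\mathrm{Hom}$'s are over the field $K$. A dialgebra over $K$ is a $K$-module $D$ with two $K$-bilinear maps $\dashv,\vdash\colon D\otimes D\to D$ (left and right product) such that for all $x,y,z$: (1) $x\dashv(y\dashv z)=(x\dashv y)\dashv z$; (2) $(x\dashv y)\dashv z=x\dashv(y\vdash z)$; (3) $(x\vdash y)\dashv z=x\vdash(y\dashv z)$; (4) $(x\dashv y)\vdash z=x\vdash(y\vdash z)$; (5) $x\vdash(y\vdash z)=(x\vdash y)\vdash z$. A morphism of dialgebras is a $K$-linear map preserving both products. A representation of $D$ is a $K$-module $M$ with left actions $\dashv,\vdash\colon D\otimes M\to M$ and right actions $\dashv,\vdash\colon M\otimes D\to M$ satisfying the fifteen identities obtained from (1)–(5) by letting exactly one of $x,y,z$ lie in $M$. $D$ is a representation of itself; given a morphism $\psi\colon D\to E$, $E$ is a representation of $D$ via $a* e=\psi(a)* e$, $e* a=e*\psi(a)$ for $*\in\{\dashv,\vdash\}$. **Trees.** $Y_n$ is the set of planar binary trees with $n+1$ leaves, numbered $0,\dots,n$ from left to right ("$n$-trees"); $Y_0=\{|\}$, and every $y\in Y_n$ with $n\ge1$ is uniquely a grafting $y=y_1\vee y_2$ (left subtree $y_1$, right subtree $y_2$). For $y\in Y_n$, $n\ge1$, $d_iy\in Y_{n-1}$ is obtained by deleting the $i$th leaf. For $y\in Y_{n+1}$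 define $\circ^y_i\in\{\dashv,\vdash\}$, $0\le i\le n+1$: $\circ^y_0=\dashv$ if $y=|\vee y_1$ for some $y_1$, and $\vdash$ otherwise; for $1\le i\le n$, $\circ^y_i=\dashv$ if the $i$th leaf is the left branch at its vertex, and $\vdash$ if it is the right branch; $\circ^y_{n+1}=\vdash$ if $y=y_1\vee|$ for some $y_1$, and $\dashv$ otherwise. **Dialgebra cochains.** For a representation $M$ of $D$, $CY^n(D,M)=\mathrm{Hom}(K[Y_n]\otimes D^{\otimes n},M)$ for $n\ge0$, and $\delta=\sum_{i=0}^{n+1}(-1)^i\delta^i\colon CY^n(D,M)\to CY^{n+1}(D,M)$, where $(\delta^if)(y\otimes(a_1,\dots,a_{n+1}))$ equals $a_1\circ^y_0f(d_0y\otimes(a_2,\dots,a_{n+1}))$ if $i=0$; $f(d_iy\otimes(\dots,a_{i-1},a_i\circ^y_ia_{i+1},a_{i+2},\dots))$ if $1\le i\le n$; and $f(d_{n+1}y\otimes(a_1,\dots,a_n))\circ^y_{n+1}a_{n+1}$ if $i=n+1$. **Deformation complex.** For $n\ge1$ put $CY^n(\psi,\psi)=CY^n(D,D)\times CY^n(E,E)\times CY^{n-1}(D,E)$ and $\delta(\xi;\pi;\varphi)=(\delta\xi;\ \delta\pi;\ \psi\xi-\pi\psi-\delta\varphi)\in CY^{n+1}(\psi,\psi)$, where $(\psi\xi)(y\otimes(a_1,\dots,a_n))=\psi(\xi(y\otimes(a_1,\dots,a_n)))$ and $(\pi\psi)(y\otimes(a_1,\dots,a_n))=\pi(y\otimes(\psi(a_1),\dots,\psi(a_n)))$.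 This is a cochain complex, and $HY^2(\psi,\psi)=\ker(\delta\colon CY^2(\psi,\psi)\to CY^3(\psi,\psi))/\delta(CY^1(\psi,\psi))$. **Deformations.** A deformation of a dialgebra $D$ is a pair of power series $f_t=(f^l_t=\sum_{n\ge0}F^l_nt^n;\ f^r_t=\sum_{n\ge0}F^r_nt^n)$ with each $F^l_n,F^r_n\colon D\otimes D\to D$ $K$-bilinear, $F^l_0=\dashv$, $F^r_0=\vdash$, such that $D[[t]]$ with left product $f^l_t$ and right product $f^r_t$ (extended to power series, i.e. $f^*_t(\sum a_it^i,\sum b_jt^j)=\sum F^*_n(a_i,b_j)t^{n+i+j}$) is a dialgebra, denoted $D_t$ or $D_t(f)$. One writes $F_n=(F^l_n;F^r_n)$ and $f_t=\sum F_nt^n$. A deformation of $\psi\colon D\to E$ is a triple $\Theta_t=(f_{D,t};f_{E,t};\Psi_t)$ where $f_{D,t}=\sum F_{D,n}t^n$ and $f_{E,t}=\sum F_{E,n}t^n$ are deformations of $D$ and $E$, and $\Psi_t=\sum_{n\ge0}\psi_nt^n\colon D_t\to E_t$ is a dialgebra morphism with each $\psi_n\colon D\to E$ $K$-linear and $\psi_0=\psi$. **Equivalence and rigidity.** A formal isomorphism $D_t(f)\to D_t(\tilde f)$ between deformations of $D$ is a power series $\Phi_t=\sum_{n\ge0}\phi_nt^n$ with each $\phi_n\colon D\to D$ $K$-linear, $\phi_0=\mathrm{Id}_D$, and $\tilde f^*_t(a,b)=\Phi_tf^*_t(\Phi_t^{-1}(a),\Phi_t^{-1}(b))$ for all $a,b\in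 D$, $*\in\{l,r\}$. For deformations $\Theta_t=(f_{D,t};f_{E,t};\Psi_t)$ and $\tilde\Theta_t=(\tilde f_{D,t};\tilde f_{E,t};\tilde\Psi_t)$ of $\psi$, a formal isomorphism $\Theta_t\to\tilde\Theta_t$ is a pair $(\Phi_{D,t};\Phi_{E,t})$ of formal isomorphisms $\Phi_{D,t}\colon D_t(f_D)\to D_t(\tilde f_D)$, $\Phi_{E,t}\colon E_t(f_E)\to E_t(\tilde f_E)$ with $\tilde\Psi_t=\Phi_{E,t}\Psi_t\Phi_{D,t}^{-1}$. $\Theta_t$ and $\tilde\Theta_t$ are equivalent iff there is a formal isomorphism $\Theta_t\to\tilde\Theta_t$. The morphism $\psi$ is rigid iff every deformation of $\psi$ is equivalent to the trivial deformation $(F_{D,0};F_{E,0};\psi)$ (the one with all coefficients of $t^n$, $n\ge1$, equal to zero). *)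

theory Defs
  imports
    "HOL-Computational_Algebra.Formal_Power_Series"
    "HOL-Library.Function_Algebras"
    "HOL-Library.Product_Plus"
    "HOL-Algebra.Elementary_Groups"
begin

text \<open>The two products are bundled into one family indexed by the two-element type
  \<open>prodsort\<close>. Since Hom out of a tensor product is the space of multilinear
  maps, a linear map on a tensor power is represented by a multilinear map throughout.\<close>

datatype prodsort = LeftP | RightP

locale dialgebra = vector_space scale
  for scale :: "'k::field \<Rightarrow> 'd::ab_group_add \<Rightarrow> 'd" +
  fixes mul :: "prodsort \<Rightarrow> 'd \<Rightarrow> 'd \<Rightarrow> 'd"
  assumes mul_linear_right: "Vector_Spaces.linear scale scale (\<lambda>y. mul c x y)"
    and mul_linear_left: "Vector_Spaces.linear scale scale (\<lambda>x. mul c x y)"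
    and dialg1: "mul LeftP x (mul LeftP y z) = mul LeftP (mul LeftP x y) z"
    and dialg2: "mul LeftP (mul LeftP x y) z = mul LeftP x (mul RightP y z)"
    and dialg3: "mul LeftP (mul RightP x y) z = mul RightP x (mul LeftP y z)"
    and dialg4: "mul RightP (mul LeftP x y) z = mul RightP x (mul RightP y z)"
    and dialg5: "mul RightP x (mul RightP y z) = mul RightP (mul RightP x y) z"

locale dialgebra_hom =
  dom: dialgebra sD mD + cod: dialgebra sE mE + Vector_Spaces.linear sD sE \<psi>
  for sD :: "'k::field \<Rightarrow> 'd::ab_group_add \<Rightarrow> 'd" and mD
    and sE :: "'k \<Rightarrow> 'e::ab_group_add \<Rightarrow> 'e" and mE
    and \<psi> :: "'d \<Rightarrow> 'e" +
  assumes hom_mul: "\<psi> (mD c x y) = mE c (\<psi> x) (\<psi> y)"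

datatype pbtree = Bar | Graft pbtree pbtree

fun leaves :: "pbtree \<Rightarrow> nat" where
  "leaves Bar = 1"
| "leaves (Graft l r) = leaves l + leaves r"

definition Y :: "nat \<Rightarrow> pbtree set" where
  "Y n = {y. leaves y = n + 1}"

text \<open>Deleting a leaf also removes the vertex it is attached to, so that the sibling subtree
  takes its place. The value on \<open>Bar\<close> is irrelevant.\<close>

fun del_leaf :: "nat \<Rightarrow> pbtree \<Rightarrow> pbtree" where
  "del_leaf i Bar = Bar"
| "del_leaf i (Graft l r) =
    (if i < leaves l then (if l = Bar then r else Graft (del_leaf i l) r)
     else (if r = Bar then l else Graft l (del_leaf (i - leaves l) r)))"

fun is_left_leaf :: "nat \<Rightarrow> pbtree \<Rightarrow> bool" where
  "is_left_leaf i Bar = False"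
| "is_left_leaf i (Graft l r) =
    (if i < leaves l then (if l = Bar then True else is_left_leaf i l)
     else (if r = Bar then False else is_left_leaf (i - leaves l) r))"

text \<open>For \<open>y \<in> Y (n + 1)\<close> the last leaf has number
  \<open>n + 1 = leaves y - 1\<close>.\<close>

definition circ :: "pbtree \<Rightarrow> nat \<Rightarrow> prodsort" where
  "circ y i =
    (if i = 0 then (if \<exists>y1. y = Graft Bar y1 then LeftP else RightP)
     else if i = leaves y - 1 then (if \<exists>y1. y = Graft y1 Bar then RightP else LeftP)
     else (if is_left_leaf i y then LeftP else RightP))"

text \<open>A cochain is a function of a tree and the list \<open>[a\<^sub>1, \<dots>, a\<^sub>n]\<close>,
  normalised to be zero on arguments outside \<open>Y n\<close> and \<open>D\<^sup>n\<close>, so that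
  equality of cochains is equality of functions.\<close>

definition CY :: "('k::field \<Rightarrow> 'd::ab_group_add \<Rightarrow> 'd) \<Rightarrow> ('k \<Rightarrow> 'm::ab_group_add \<Rightarrow> 'm)
    \<Rightarrow> nat \<Rightarrow> (pbtree \<Rightarrow> 'd list \<Rightarrow> 'm) set" where
  "CY sD sM n = {f.
     (\<forall>y\<in>Y n. \<forall>as i. length as = n \<and> i < n \<longrightarrow>
        Vector_Spaces.linear sD sM (\<lambda>x. f y (as[i := x]))) \<and>
     (\<forall>y as. y \<notin> Y n \<or> length as \<noteq> n \<longrightarrow> f y as = 0)}"

text \<open>The coboundary for a representation with left action \<open>la\<close> and right action
  \<open>ra\<close>. In the list \<open>as\<close> the entry \<open>a\<^sub>i\<close> is \<open>as ! (i - 1)\<close>.\<close>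

definition face ::
  "(prodsort \<Rightarrow> 'd \<Rightarrow> 'd \<Rightarrow> 'd) \<Rightarrow> (prodsort \<Rightarrow> 'd \<Rightarrow> 'm \<Rightarrow> 'm) \<Rightarrow> (prodsort \<Rightarrow> 'm \<Rightarrow> 'd \<Rightarrow> 'm) \<Rightarrow> nat
    \<Rightarrow> nat \<Rightarrow> (pbtree \<Rightarrow> 'd list \<Rightarrow> 'm) \<Rightarrow> pbtree \<Rightarrow> 'd list \<Rightarrow> 'm" where
  "face mD la ra n i f y as =
    (if i = 0 then la (circ y 0) (hd as) (f (del_leaf 0 y) (tl as))
     else if i \<le> n then
       f (del_leaf i y)
         (take (i - 1) as @ [mD (circ y i) (as ! (i - 1)) (as ! i)] @ drop (i + 1) as)
     else ra (circ y (n + 1)) (f (del_leaf (n + 1) y) (butlast as)) (last as))"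

definition cobd ::
  "(prodsort \<Rightarrow> 'd \<Rightarrow> 'd \<Rightarrow> 'd) \<Rightarrow> (prodsort \<Rightarrow> 'd \<Rightarrow> 'm \<Rightarrow> 'm) \<Rightarrow> (prodsort \<Rightarrow> 'm \<Rightarrow> 'd \<Rightarrow> 'm) \<Rightarrow> nat
    \<Rightarrow> (pbtree \<Rightarrow> 'd list \<Rightarrow> 'm::ab_group_add) \<Rightarrow> pbtree \<Rightarrow> 'd list \<Rightarrow> 'm" where
  "cobd mD la ra n f = (\<lambda>y as.
     if y \<in> Y (n + 1) \<and> length as = n + 1
     then (\<Sum>i=0..n+1. if even i then face mD la ra n i f y as else - face mD la ra n i f y as)
     else 0)"

type_synonym ('d, 'e) triple_cochain =
  "(pbtree \<Rightarrow> 'd list \<Rightarrow> 'd) \<times> (pbtree \<Rightarrow> 'e list \<Rightarrow> 'e) \<times> (pbtree \<Rightarrow> 'd list \<Rightarrow> 'e)"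

definition CYmor :: "('k::field \<Rightarrow> 'd::ab_group_add \<Rightarrow> 'd) \<Rightarrow> ('k \<Rightarrow> 'e::ab_group_add \<Rightarrow> 'e)
    \<Rightarrow> nat \<Rightarrow> ('d, 'e) triple_cochain set" where
  "CYmor sD sE n = CY sD sD n \<times> CY sE sE n \<times> CY sD sE (n - 1)"

text \<open>Only used for \<open>n \<ge> 1\<close>. In the third component E is a representation of D
  through \<open>\<psi>\<close>.\<close>

fun cobd_mor :: "(prodsort \<Rightarrow> 'd \<Rightarrow> 'd \<Rightarrow> 'd) \<Rightarrow> (prodsort \<Rightarrow> 'e \<Rightarrow> 'e \<Rightarrow> 'e)
    \<Rightarrow> ('d::ab_group_add \<Rightarrow> 'e::ab_group_add) \<Rightarrow> nat
    \<Rightarrow> ('d, 'e) triple_cochain \<Rightarrow> ('d, 'e) triple_cochain" where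
  "cobd_mor mD mE \<psi> n (\<xi>, \<pi>, \<phi>) =
    (cobd mD mD mD n \<xi>,
     cobd mE mE mE n \<pi>,
     (\<lambda>y as. \<psi> (\<xi> y as)) - (\<lambda>y as. \<pi> y (map \<psi> as))
       - cobd mD (\<lambda>c a e. mE c (\<psi> a) e) (\<lambda>c e a. mE c e (\<psi> a)) (n - 1) \<phi>)"

definition Z2_mor where
  "Z2_mor sD mD sE mE \<psi> = {x \<in> CYmor sD sE 2. cobd_mor mD mE \<psi> 2 x = 0}"

definition B2_mor where
  "B2_mor sD mD sE mE \<psi> = cobd_mor mD mE \<psi> 1 ` CYmor sD sE 1"

definition HY2 :: "('k::field \<Rightarrow> 'd::ab_group_add \<Rightarrow> 'd) \<Rightarrow> (prodsort \<Rightarrow> 'd \<Rightarrow> 'd \<Rightarrow> 'd)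
    \<Rightarrow> ('k \<Rightarrow> 'e::ab_group_add \<Rightarrow> 'e) \<Rightarrow> (prodsort \<Rightarrow> 'e \<Rightarrow> 'e \<Rightarrow> 'e) \<Rightarrow> ('d \<Rightarrow> 'e)
    \<Rightarrow> ('d, 'e) triple_cochain set monoid" where
  "HY2 sD mD sE mE \<psi> =
    \<lparr>carrier = Z2_mor sD mD sE mE \<psi>, monoid.mult = (+), one = 0\<rparr> Mod B2_mor sD mD sE mE \<psi>"

text \<open>\<open>D[[t]]\<close> is the type \<open>'d fps\<close>, with K acting coefficientwise.\<close>

definition fps_scale :: "('k \<Rightarrow> 'd \<Rightarrow> 'd) \<Rightarrow> 'k \<Rightarrow> 'd::ab_group_add fps \<Rightarrow> 'd fps" where
  "fps_scale s k a = Abs_fps (\<lambda>n. s k (fps_nth a n))"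

definition fps_mul :: "(nat \<Rightarrow> prodsort \<Rightarrow> 'd \<Rightarrow> 'd \<Rightarrow> 'd)
    \<Rightarrow> prodsort \<Rightarrow> 'd::ab_group_add fps \<Rightarrow> 'd fps \<Rightarrow> 'd fps" where
  "fps_mul F c a b = Abs_fps (\<lambda>N.
     \<Sum>(n, i, j) \<in> {(n, i, j). n + i + j = N}. F n c (fps_nth a i) (fps_nth b j))"

lemma finite_fps_mul_index: "finite {(n, i, j). n + i + j = (N::nat)}"
  by (rule finite_subset[of _ "{..N} \<times> {..N} \<times> {..N}"]) auto

definition fps_apply :: "(nat \<Rightarrow> 'd \<Rightarrow> 'e) \<Rightarrow> 'd::ab_group_add fps \<Rightarrow> 'e::ab_group_add fps" where
  "fps_apply \<Phi> a = Abs_fps (\<lambda>N. \<Sum>n\<le>N. \<Phi> n (fps_nth a (N - n)))"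

definition dialgebra_deformation :: "('k::field \<Rightarrow> 'd::ab_group_add \<Rightarrow> 'd)
    \<Rightarrow> (prodsort \<Rightarrow> 'd \<Rightarrow> 'd \<Rightarrow> 'd) \<Rightarrow> (nat \<Rightarrow> prodsort \<Rightarrow> 'd \<Rightarrow> 'd \<Rightarrow> 'd) \<Rightarrow> bool" where
  "dialgebra_deformation s m F \<longleftrightarrow>
     (\<forall>n c x. Vector_Spaces.linear s s (\<lambda>y. F n c x y)) \<and>
     (\<forall>n c y. Vector_Spaces.linear s s (\<lambda>x. F n c x y)) \<and>
     F 0 = m \<and>
     dialgebra (fps_scale s) (fps_mul F)"

type_synonym ('d, 'e) def_triple =
  "(nat \<Rightarrow> prodsort \<Rightarrow> 'd \<Rightarrow> 'd \<Rightarrow> 'd) \<times> (nat \<Rightarrow> prodsort \<Rightarrow> 'e \<Rightarrow> 'e \<Rightarrow> 'e) \<times> (nat \<Rightarrow> 'd \<Rightarrow> 'e)"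

fun morphism_deformation :: "('k::field \<Rightarrow> 'd::ab_group_add \<Rightarrow> 'd) \<Rightarrow> (prodsort \<Rightarrow> 'd \<Rightarrow> 'd \<Rightarrow> 'd)
    \<Rightarrow> ('k \<Rightarrow> 'e::ab_group_add \<Rightarrow> 'e) \<Rightarrow> (prodsort \<Rightarrow> 'e \<Rightarrow> 'e \<Rightarrow> 'e) \<Rightarrow> ('d \<Rightarrow> 'e)
    \<Rightarrow> ('d, 'e) def_triple \<Rightarrow> bool" where
  "morphism_deformation sD mD sE mE \<psi> (FD, FE, \<Psi>) \<longleftrightarrow>
     dialgebra_deformation sD mD FD \<and>
     dialgebra_deformation sE mE FE \<and>
     (\<forall>n. Vector_Spaces.linear sD sE (\<Psi> n)) \<and> \<Psi> 0 = \<psi> \<and>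
     dialgebra_hom (fps_scale sD) (fps_mul FD) (fps_scale sE) (fps_mul FE) (fps_apply \<Psi>)"

text \<open>A power series with constant term the identity acts bijectively on
  \<open>D[[t]]\<close>, so its inverse is the inverse function.\<close>

fun fps_solve :: "(nat \<Rightarrow> 'd \<Rightarrow> 'd) \<Rightarrow> 'd::ab_group_add fps \<Rightarrow> nat \<Rightarrow> 'd" where
  "fps_solve \<Phi> b N = fps_nth b N - (\<Sum>n\<in>{1..N}. \<Phi> n (fps_solve \<Phi> b (N - n)))"

declare fps_solve.simps [simp del]

lemma bij_fps_apply:
  fixes \<Phi> :: "nat \<Rightarrow> 'd::ab_group_add \<Rightarrow> 'd"
  assumes "\<Phi> 0 = id"
  shows "bij (fps_apply \<Phi>)"
proof -
  have nth: "fps_nth (fps_apply \<Phi> a) N = fps_nth a N + (\<Sum>n\<in>{1..N}. \<Phi> n (fps_nth a (N - n)))"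
    for a :: "'d fps" and N
  proof -
    have "{..N} = insert 0 {1..N}" by auto
    then show ?thesis using assms by (simp add: fps_apply_def)
  qed
  have "a = b" if eq: "fps_apply \<Phi> a = fps_apply \<Phi> b" for a b :: "'d fps"
  proof (rule fps_ext)
    fix N
    show "fps_nth a N = fps_nth b N"
    proof (induction N rule: less_induct)
      case (less N)
      have "(\<Sum>n\<in>{1..N}. \<Phi> n (fps_nth a (N - n))) = (\<Sum>n\<in>{1..N}. \<Phi> n (fps_nth b (N - n)))"
        by (rule sum.cong) (auto simp: less)
      with nth[of a N] nth[of b N] eq show ?case by simp
    qed
  qed
  moreover have "b = fps_apply \<Phi> (Abs_fps (fps_solve \<Phi> b))" for b :: "'d fps"
  proof (rule fps_ext)
    fix N
    show "fps_nth b N = fps_nth (fps_apply \<Phi> (Abs_fps (fps_solve \<Phi> b))) N"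
      unfolding nth by (simp add: fps_solve.simps[of \<Phi> b N])
  qed
  ultimately show ?thesis unfolding bij_def inj_def surj_def by blast
qed

definition fps_apply_inv :: "(nat \<Rightarrow> 'd \<Rightarrow> 'd) \<Rightarrow> 'd::ab_group_add fps \<Rightarrow> 'd fps" where
  "fps_apply_inv \<Phi> = the_inv (fps_apply \<Phi>)"

definition formal_iso :: "('k::field \<Rightarrow> 'd::ab_group_add \<Rightarrow> 'd)
    \<Rightarrow> (nat \<Rightarrow> prodsort \<Rightarrow> 'd \<Rightarrow> 'd \<Rightarrow> 'd) \<Rightarrow> (nat \<Rightarrow> prodsort \<Rightarrow> 'd \<Rightarrow> 'd \<Rightarrow> 'd)
    \<Rightarrow> (nat \<Rightarrow> 'd \<Rightarrow> 'd) \<Rightarrow> bool" where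
  "formal_iso s F F' \<Phi> \<longleftrightarrow>
     (\<forall>n. Vector_Spaces.linear s s (\<Phi> n)) \<and> \<Phi> 0 = id \<and>
     (\<forall>c a b. Abs_fps (\<lambda>n. F' n c a b) =
        fps_apply \<Phi> (fps_mul F c (fps_apply_inv \<Phi> (fps_const a)) (fps_apply_inv \<Phi> (fps_const b))))"

fun morphism_formal_iso :: "('k::field \<Rightarrow> 'd::ab_group_add \<Rightarrow> 'd) \<Rightarrow> ('k \<Rightarrow> 'e::ab_group_add \<Rightarrow> 'e)
    \<Rightarrow> ('d, 'e) def_triple \<Rightarrow> ('d, 'e) def_triple
    \<Rightarrow> (nat \<Rightarrow> 'd \<Rightarrow> 'd) \<times> (nat \<Rightarrow> 'e \<Rightarrow> 'e) \<Rightarrow> bool" where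
  "morphism_formal_iso sD sE (FD, FE, \<Psi>) (FD', FE', \<Psi>') (\<Phi>D, \<Phi>E) \<longleftrightarrow>
     formal_iso sD FD FD' \<Phi>D \<and> formal_iso sE FE FE' \<Phi>E \<and>
     fps_apply \<Psi>' = fps_apply \<Phi>E \<circ> fps_apply \<Psi> \<circ> fps_apply_inv \<Phi>D"

definition equivalent_deformations :: "('k::field \<Rightarrow> 'd::ab_group_add \<Rightarrow> 'd)
    \<Rightarrow> ('k \<Rightarrow> 'e::ab_group_add \<Rightarrow> 'e) \<Rightarrow> ('d, 'e) def_triple \<Rightarrow> ('d, 'e) def_triple \<Rightarrow> bool" where
  "equivalent_deformations sD sE \<Theta> \<Theta>' \<longleftrightarrow> (\<exists>\<Phi>. morphism_formal_iso sD sE \<Theta> \<Theta>' \<Phi>)"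

definition trivial_deformation :: "(prodsort \<Rightarrow> 'd \<Rightarrow> 'd \<Rightarrow> 'd) \<Rightarrow> (prodsort \<Rightarrow> 'e \<Rightarrow> 'e \<Rightarrow> 'e)
    \<Rightarrow> ('d \<Rightarrow> 'e) \<Rightarrow> ('d::zero, 'e::zero) def_triple" where
  "trivial_deformation mD mE \<psi> =
     ((\<lambda>n. if n = 0 then mD else (\<lambda>c x y. 0)),
      (\<lambda>n. if n = 0 then mE else (\<lambda>c x y. 0)),
      (\<lambda>n. if n = 0 then \<psi> else (\<lambda>x. 0)))"

definition rigid :: "('k::field \<Rightarrow> 'd::ab_group_add \<Rightarrow> 'd) \<Rightarrow> (prodsort \<Rightarrow> 'd \<Rightarrow> 'd \<Rightarrow> 'd)
    \<Rightarrow> ('k \<Rightarrow> 'e::ab_group_add \<Rightarrow> 'e) \<Rightarrow> (prodsort \<Rightarrow> 'e \<Rightarrow> 'e \<Rightarrow> 'e) \<Rightarrow> ('d \<Rightarrow> 'e) \<Rightarrow> bool" where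
  "rigid sD mD sE mE \<psi> \<longleftrightarrow>
     (\<forall>\<Theta>. morphism_deformation sD mD sE mE \<psi> \<Theta> \<longrightarrow>
        equivalent_deformations sD sE \<Theta> (trivial_deformation mD mE \<psi>))"

end

theory Submission
  imports Defs
begin

text \<open>A deformation is equivalent to the trivial one iff there are series \<open>\<Phi>\<^sub>D\<close>, \<open>\<Phi>\<^sub>E\<close> with
  constant term the identity such that \<open>\<Phi>\<^sub>D\<close> and \<open>\<Phi>\<^sub>E\<close> carry the deformed products to the
  original ones and \<open>\<Phi>\<^sub>E \<Psi>\<^sub>t = \<psi> \<Phi>\<^sub>D\<close>. They are built one coefficient at a time. If these three
  equations hold below order \<open>N\<close>, their defects of order \<open>N\<close> form a 2-cocycle: expand
  \<open>\<Phi> (x * (y * z)) = \<Phi> ((x * y) * z)\<close> and \<open>\<Phi>\<^sub>E (\<Psi>\<^sub>t (x * y)) = \<Phi>\<^sub>E (\<Psi>\<^sub>t x * \<Psi>\<^sub>t y)\<close> (deformed products)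
  up to order \<open>N\<close>. As the cocycle is a coboundary, it can be cancelled by changing the
  coefficients of order \<open>N\<close> of \<open>\<Phi>\<^sub>D\<close> and \<open>\<Phi>\<^sub>E\<close>, which does not affect lower orders.\<close>

text \<open>A quadruple \<open>(c, c', e, e')\<close> stands for the law
  \<open>x *\<^sub>c (y *\<^bsub>c'\<^esub> z) = (x *\<^bsub>e'\<^esub> y) *\<^sub>e z\<close>, so that the five axioms can be
  treated uniformly.\<close>

definition dialgebra_laws :: "(prodsort \<times> prodsort \<times> prodsort \<times> prodsort) set" where
  "dialgebra_laws =
     {(LeftP, LeftP, LeftP, LeftP), (LeftP, RightP, LeftP, LeftP), (RightP, LeftP, LeftP, RightP),
      (RightP, RightP, RightP, LeftP), (RightP, RightP, RightP, RightP)}"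

lemma (in dialgebra) mul_law:
  assumes "(c, c', e, e') \<in> dialgebra_laws"
  shows "mul c x (mul c' y z) = mul e (mul e' x y) z"
  using assms dialg1 dialg2 dialg3 dialg4 dialg5 by (auto simp: dialgebra_laws_def)

section \<open>Additive and biadditive maps\<close>

lemma linear_imp_additive: "Vector_Spaces.linear s s' f \<Longrightarrow> additive f"
  by (simp add: additive_def linear_iff_module_hom module_hom.add)

text \<open>Additivity drives all coefficient computations below, and it passes from a product to
  its extension to power series.\<close>

definition biadditive :: "('c \<Rightarrow> 'a::ab_group_add \<Rightarrow> 'b::ab_group_add \<Rightarrow> 'm::ab_group_add) \<Rightarrow> bool" where
  "biadditive m \<longleftrightarrow> (\<forall>c x. additive (\<lambda>y. m c x y)) \<and> (\<forall>c y. additive (\<lambda>x. m c x y))"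

lemma (in dialgebra) biadditive_mul: "biadditive mul"
  unfolding biadditive_def
  using linear_imp_additive[OF mul_linear_left] linear_imp_additive[OF mul_linear_right] by blast

lemma biadditiveD:
  assumes "biadditive m"
  shows "m c (x + x') y = m c x y + m c x' y" "m c x (y + y') = m c x y + m c x y'"
    "m c (x - x') y = m c x y - m c x' y" "m c x (y - y') = m c x y - m c x y'"
    "m c 0 y = 0" "m c x 0 = 0"
    "m c (sum f A) y = (\<Sum>i\<in>A. m c (f i) y)" "m c x (sum g A) = (\<Sum>i\<in>A. m c x (g i))"
proof -
  have l: "additive (\<lambda>x. m c x y)" and r: "additive (\<lambda>y. m c x y)" for c x y
    using assms by (auto simp: biadditive_def)
  show "m c (x + x') y = m c x y + m c x' y" "m c (x - x') y = m c x y - m c x' y" "m c 0 y = 0"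
    "m c (sum f A) y = (\<Sum>i\<in>A. m c (f i) y)"
    using additive.add[OF l] additive.diff[OF l] additive.zero[OF l] additive.sum[OF l] by blast+
  show "m c x (y + y') = m c x y + m c x y'" "m c x (y - y') = m c x y - m c x y'" "m c x 0 = 0"
    "m c x (sum g A) = (\<Sum>i\<in>A. m c x (g i))"
    using additive.add[OF r] additive.diff[OF r] additive.zero[OF r] additive.sum[OF r] by blast+
qed

subsection \<open>Trees and cochains of low degree\<close>

lemma leaves_pos: "leaves y > 0"
  by (induction y) auto

lemma Y_0: "Y 0 = {Bar}"
proof -
  have "leaves y = 1 \<longleftrightarrow> y = Bar" for y
  proof (cases y)
    case (Graft l r)
    then show ?thesis using leaves_pos[of l] leaves_pos[of r] by simp
  qed simp
  then show ?thesis by (auto simp: Y_def)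
qed

lemma Graft_in_Y: "Graft l r \<in> Y (Suc n) \<longleftrightarrow> (\<exists>i\<le>n. l \<in> Y i \<and> r \<in> Y (n - i))"
proof
  assume "Graft l r \<in> Y (Suc n)"
  \<comment> \<open>The index is \<open>leaves l - 1\<close> because \<open>Y i\<close> consists of
    the trees with \<open>i + 1\<close> leaves.\<close>
  then have "leaves l - 1 \<le> n \<and> l \<in> Y (leaves l - 1) \<and> r \<in> Y (n - (leaves l - 1))"
    using leaves_pos[of l] leaves_pos[of r] by (auto simp: Y_def)
  then show "\<exists>i\<le>n. l \<in> Y i \<and> r \<in> Y (n - i)" by blast
qed (auto simp: Y_def)

lemma Y_Suc: "Y (Suc n) = (\<Union>i\<le>n. \<Union>l\<in>Y i. Graft l ` Y (n - i))"
proof (rule Set.set_eqI)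
  show "y \<in> Y (Suc n) \<longleftrightarrow> y \<in> (\<Union>i\<le>n. \<Union>l\<in>Y i. Graft l ` Y (n - i))" for y
    by (cases y) (auto simp: Graft_in_Y, auto simp: Y_def)
qed

lemma Y_1: "Y 1 = {Graft Bar Bar}"
  by (simp add: Y_Suc Y_0)

text \<open>Through this bijection a 2-cochain is a pair of bilinear maps, one for each product.\<close>

fun tree_of_sort :: "prodsort \<Rightarrow> pbtree" where
  "tree_of_sort LeftP = Graft Bar (Graft Bar Bar)"
| "tree_of_sort RightP = Graft (Graft Bar Bar) Bar"

lemma Y_2: "Y 2 = range tree_of_sort"
proof -
  have UNIV_prodsort: "UNIV = {LeftP, RightP}"
    using prodsort.exhaust by blast
  show ?thesis
    unfolding UNIV_prodsort by (auto simp: Y_Suc Y_0 numeral_2_eq_2 atMost_Suc)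
qed

text \<open>One tree for each dialgebra axiom, in the order \<open>dialg1\<close> to
  \<open>dialg5\<close>.\<close>

lemma Y_3: "Y 3 =
    {Graft Bar (tree_of_sort LeftP), Graft Bar (tree_of_sort RightP), Graft (Graft Bar Bar) (Graft Bar Bar),
     Graft (tree_of_sort LeftP) Bar, Graft (tree_of_sort RightP) Bar}"
  using Y_1 by (auto simp: Y_Suc Y_0 numeral_3_eq_3 atMost_Suc)

lemma tree_of_sort_in_Y [simp]: "tree_of_sort c \<in> Y 2" by (simp add: Y_2)

text \<open>On a 2-tree all labels coincide, so the coboundary of a 1-cochain involves only one
  product on each tree.\<close>

lemma circ_tree_of_sort:
  "circ (tree_of_sort c) 0 = c" "circ (tree_of_sort c) (Suc 0) = c" "circ (tree_of_sort c) 2 = c"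
  by (cases c; simp add: circ_def)+

lemma del_leaf_tree_of_sort: "i \<le> 2 \<Longrightarrow> del_leaf i (tree_of_sort c) = Graft Bar Bar"
  by (cases c; cases "i = 0"; cases "i = 1"; cases "i = 2"; simp)

definition cochain1 :: "('a \<Rightarrow> 'm) \<Rightarrow> pbtree \<Rightarrow> 'a list \<Rightarrow> 'm::zero" where
  "cochain1 f = (\<lambda>y as. if y \<in> Y 1 \<and> length as = 1 then f (hd as) else 0)"

text \<open>\<open>circ y 1\<close> inverts \<open>tree_of_sort\<close>, so \<open>G\<close> can be
  indexed by the product instead of the tree.\<close>

definition cochain2 :: "(prodsort \<Rightarrow> 'a \<Rightarrow> 'a \<Rightarrow> 'm) \<Rightarrow> pbtree \<Rightarrow> 'a list \<Rightarrow> 'm::zero" where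
  "cochain2 G = (\<lambda>y as. if y \<in> Y 2 \<and> length as = 2 then G (circ y 1) (as ! 0) (as ! 1) else 0)"

lemma length_2E:
  assumes "length xs = 2" obtains a b where "xs = [a, b]"
  using assms by (auto simp: numeral_2_eq_2 length_Suc_conv)

lemma length_3E:
  assumes "length xs = 3" obtains a b c where "xs = [a, b, c]"
  using assms by (auto simp: numeral_3_eq_3 length_Suc_conv)

lemma length_1E:
  assumes "length xs = 1" obtains a where "xs = [a]"
  using assms by (auto simp: length_Suc_conv)

lemma cochain1_apply: "cochain1 f (Graft Bar Bar) [a] = f a"
  by (simp add: cochain1_def Y_1 [simplified])

lemma cochain2_apply: "cochain2 G (tree_of_sort c) [a, b] = G c a b"
  by (simp add: cochain2_def circ_tree_of_sort)

lemma cochain1_eqI: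
  assumes "\<And>y as. y \<notin> Y 1 \<or> length as \<noteq> 1 \<Longrightarrow> g y as = 0" "\<And>a. g (Graft Bar Bar) [a] = f a"
  shows "g = cochain1 f"
proof (intro ext)
  show "g y as = cochain1 f y as" for y as
    using assms by (cases "y \<in> Y 1 \<and> length as = 1")
      (auto simp: cochain1_def Y_1 [simplified] elim!: length_1E [simplified])
qed

lemma cochain2_eqI:
  assumes "\<And>y as. y \<notin> Y 2 \<or> length as \<noteq> 2 \<Longrightarrow> g y as = 0" "\<And>c a b. g (tree_of_sort c) [a, b] = G c a b"
  shows "g = cochain2 G"
proof (intro ext)
  show "g y as = cochain2 G y as" for y as
  proof (cases "y \<in> Y 2 \<and> length as = 2")
    case True
    then show ?thesis using assms(2) by (auto simp: Y_2 cochain2_apply elim!: length_2E)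
  qed (use assms(1) in \<open>auto simp: cochain2_def\<close>)
qed

lemma cochain2_inject: "cochain2 F = cochain2 G \<longleftrightarrow> F = G"
  by (metis cochain2_apply ext)

lemma cochain1_in_CY:
  assumes "Vector_Spaces.linear s s' f"
  shows "cochain1 f \<in> CY s s' 1"
  using assms by (auto simp: CY_def cochain1_def length_Suc_conv)

lemma cochain2_in_CY:
  assumes "\<And>c x. Vector_Spaces.linear s s' (\<lambda>y. G c x y)" "\<And>c y. Vector_Spaces.linear s s' (\<lambda>x. G c x y)"
  shows "cochain2 G \<in> CY s s' 2"
  using assms by (auto simp: CY_def cochain2_def less_2_cases_iff elim!: length_2E)

lemma CY_1_linear:
  assumes "f \<in> CY s s' 1"
  shows "Vector_Spaces.linear s s' (\<lambda>x. f (Graft Bar Bar) [x])"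
proof -
  have "Graft Bar Bar \<in> Y 1" by (simp add: Y_1 [simplified])
  \<comment> \<open>The entry \<open>undefined\<close> is overwritten at once; it only provides a
    list of length 1, as \<open>CY\<close> speaks of list updates.\<close>
  then have "Vector_Spaces.linear s s' (\<lambda>x. f (Graft Bar Bar) ([undefined][0 := x]))"
    using assms unfolding CY_def by fastforce
  then show ?thesis by simp
qed

text \<open>Both subtrees of the 1-tree are single leaves, so its first label is
  \<open>LeftP\<close> and its last one \<open>RightP\<close>. The result is the inner derivation
  given by the element \<open>e Bar []\<close>.\<close>

lemma cobd_0:
  "cobd mD la ra 0 e = cochain1 (\<lambda>a. la LeftP a (e Bar []) - ra RightP (e Bar []) a)"
  by (rule cochain1_eqI) (auto simp: cobd_def face_def Y_1 [simplified] circ_def)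

text \<open>For each product, the failure of the 1-cochain to be a derivation.\<close>

lemma cobd_1:
  "cobd mD la ra 1 f = cochain2 (\<lambda>c a b.
     la c a (f (Graft Bar Bar) [b]) - f (Graft Bar Bar) [mD c a b] + ra c (f (Graft Bar Bar) [a]) b)"
proof (rule cochain2_eqI)
  have "{0..1 + 1 :: nat} = {0, 1, 2}" by auto
  then show "cobd mD la ra 1 f (tree_of_sort c) [a, b] =
      la c a (f (Graft Bar Bar) [b]) - f (Graft Bar Bar) [mD c a b] + ra c (f (Graft Bar Bar) [a]) b" for c a b
    by (simp add: cobd_def face_def circ_tree_of_sort del_leaf_tree_of_sort numeral_2_eq_2[symmetric])
qed (auto simp: cobd_def simp flip: numeral_2_eq_2)

text \<open>The 3-tree of the law \<open>(c, c', e, e')\<close> has the labels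
  \<open>c, e', c', e\<close>, and deleting its leaves 0 to 3 yields the 2-trees of
  \<open>c', e, c, e'\<close>. Thus its four faces are, up to sign, the four terms of the linearised
  law.\<close>

lemma cobd_2_cochain2_eq_0:
  assumes "\<And>c c' e e' x y z. (c, c', e, e') \<in> dialgebra_laws \<Longrightarrow>
    m c x (G c' y z) + G c x (m c' y z) = m e (G e' x y) z + G e (m e' x y) z"
  shows "cobd m m m 2 (cochain2 G) = 0"
proof (intro ext)
  fix y as
  show "cobd m m m 2 (cochain2 G) y as = 0 y as"
  proof (cases "y \<in> Y 3 \<and> length as = 3")
    case True
    then obtain a b c where as: "as = [a, b, c]" by (blast elim: length_3E)
    have cobd: "cobd m m m 2 (cochain2 G) y [a, b, c] =
        m (circ y 0) a (cochain2 G (del_leaf 0 y) [b, c])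
        - cochain2 G (del_leaf 1 y) [m (circ y 1) a b, c]
        + cochain2 G (del_leaf 2 y) [a, m (circ y 2) b c]
        - m (circ y 3) (cochain2 G (del_leaf 3 y) [a, b]) c"
    proof -
      have "{0..2 + 1 :: nat} = {0, 1, 2, 3}" by auto
      then show ?thesis using True by (simp add: cobd_def face_def as)
    qed
    \<comment> \<open>The faces come out as explicit graftings, so the evaluation rule is needed in
      that form.\<close>
    note left = cochain2_apply[of _ LeftP, unfolded tree_of_sort.simps]
    note right = cochain2_apply[of _ RightP, unfolded tree_of_sort.simps]
    from True consider (1) "y = Graft Bar (tree_of_sort LeftP)" | (2) "y = Graft Bar (tree_of_sort RightP)"
      | (3) "y = Graft (Graft Bar Bar) (Graft Bar Bar)"
      | (4) "y = Graft (tree_of_sort LeftP) Bar" | (5) "y = Graft (tree_of_sort RightP) Bar"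
      unfolding Y_3 by blast
    then have "cobd m m m 2 (cochain2 G) y [a, b, c] = 0"
    proof cases
      case 1
      show ?thesis unfolding cobd using assms[of LeftP LeftP LeftP LeftP a b c]
        by (simp add: 1 circ_def left right dialgebra_laws_def algebra_simps)
    next
      case 2
      show ?thesis unfolding cobd using assms[of LeftP RightP LeftP LeftP a b c]
        by (simp add: 2 circ_def left right dialgebra_laws_def algebra_simps)
    next
      case 3
      show ?thesis unfolding cobd using assms[of RightP LeftP LeftP RightP a b c]
        by (simp add: 3 circ_def left right dialgebra_laws_def algebra_simps)
    next
      case 4
      show ?thesis unfolding cobd using assms[of RightP RightP RightP LeftP a b c]
        by (simp add: 4 circ_def left right dialgebra_laws_def algebra_simps)
    next
      case 5
      show ?thesis unfolding cobd using assms[of RightP RightP RightP RightP a b c]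
        by (simp add: 5 circ_def left right dialgebra_laws_def algebra_simps)
    qed
    then show ?thesis by (simp add: as)
  qed (auto simp: cobd_def)
qed

subsection \<open>Vanishing of the second cohomology group\<close>

text \<open>The unit of the quotient is \<open>B2_mor\<close> itself, so triviality makes every
  coset equal to it; each cocycle lies in its own coset because 0 is a coboundary.\<close>

lemma HY2_trivial_imp_coboundary:
  assumes "trivial_group (HY2 sD mD sE mE \<psi>)" and "0 \<in> B2_mor sD mD sE mE \<psi>"
  shows "Z2_mor sD mD sE mE \<psi> \<subseteq> B2_mor sD mD sE mE \<psi>"
proof
  let ?B = "B2_mor sD mD sE mE \<psi>"
  let ?G = "\<lparr>carrier = Z2_mor sD mD sE mE \<psi>, monoid.mult = (+), one = 0\<rparr>"
  fix x assume "x \<in> Z2_mor sD mD sE mE \<psi>"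
  then have "?B #>\<^bsub>?G\<^esub> x \<in> carrier (HY2 sD mD sE mE \<psi>)"
    by (auto simp: HY2_def FactGroup_def RCOSETS_def)
  also have "\<dots> = {?B}"
    using assms(1) by (simp add: trivial_group_def HY2_def FactGroup_def)
  finally have "?B #>\<^bsub>?G\<^esub> x = ?B" by simp
  moreover have "0 + x \<in> ?B #>\<^bsub>?G\<^esub> x"
    using assms(2) unfolding r_coset_def by fastforce
  ultimately show "x \<in> ?B" by simp
qed

text \<open>The coboundary of a 1-cochain of the regular representation; it vanishes iff \<chi>
  obeys the Leibniz rule for both products.\<close>

definition coboundary :: "(prodsort \<Rightarrow> 'a \<Rightarrow> 'a \<Rightarrow> 'a) \<Rightarrow> ('a \<Rightarrow> 'a) \<Rightarrow> prodsort \<Rightarrow> 'a \<Rightarrow> 'a \<Rightarrow> 'a::ab_group_add" where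
  "coboundary m \<chi> c a b = m c a (\<chi> b) - \<chi> (m c a b) + m c (\<chi> a) b"

text \<open>Inner derivations are cocycles. This lets the 0-cochain in the third component of a
  1-cochain of \<open>\<psi>\<close> be absorbed into the second one.\<close>

lemma (in dialgebra) coboundary_add_inner:
  "coboundary mul (\<lambda>x. \<chi> x + (mul LeftP x e - mul RightP e x)) = coboundary mul \<chi>"
proof (intro ext)
  show "coboundary mul (\<lambda>x. \<chi> x + (mul LeftP x e - mul RightP e x)) c a b = coboundary mul \<chi> c a b" for c a b
    by (cases c) (simp_all add: coboundary_def biadditiveD[OF biadditive_mul]
      dialg1 dialg2 dialg3 dialg4 dialg5 algebra_simps)
qed

context dialgebra_hom
begin

lemma cobd_mor_1:
  "cobd_mor mD mE \<psi> 1 (f, g, e) =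
    (cochain2 (coboundary mD (\<lambda>a. f (Graft Bar Bar) [a])),
     cochain2 (coboundary mE (\<lambda>a. g (Graft Bar Bar) [a])),
     (\<lambda>y as. \<psi> (f y as) - g y (map \<psi> as))
       - cochain1 (\<lambda>a. mE LeftP (\<psi> a) (e Bar []) - mE RightP (e Bar []) (\<psi> a)))"
  by (simp add: cobd_0 cobd_1[simplified] coboundary_def[abs_def] fun_diff_def)

lemma linear_zero_fun: "Vector_Spaces.linear sD sD (\<lambda>x. 0)" "Vector_Spaces.linear sE sE (\<lambda>x. 0)"
  "Vector_Spaces.linear sD sE (\<lambda>x. 0)"
  unfolding module_hom_iff_linear[symmetric]
  by (intro module_pair.module_hom_zero module_pair.intro dom.module_axioms cod.module_axioms)+

lemma zero_in_B2_mor: "0 \<in> B2_mor sD mD sE mE \<psi>"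
proof -
  have "(0, 0, 0) \<in> CYmor sD sE 1"
    using linear_zero_fun by (simp add: CYmor_def CY_def)
  moreover have "cobd_mor mD mE \<psi> 1 (0, 0, 0) = 0"
  proof -
    have "coboundary mD (\<lambda>a. 0) = 0" "coboundary mE (\<lambda>a. 0) = 0"
      using biadditiveD[OF dom.biadditive_mul] biadditiveD[OF cod.biadditive_mul]
      by (auto simp: coboundary_def fun_eq_iff)
    then show ?thesis
      unfolding cobd_mor_1 using biadditiveD[OF cod.biadditive_mul]
      by (auto simp: cochain2_def cochain1_def fun_eq_iff zero_prod_def)
  qed
  ultimately show ?thesis unfolding B2_mor_def by (metis image_eqI)
qed

text \<open>The vanishing of the cohomology group in terms of bilinear maps. The last three
  assumptions say that \<open>(GD; GE; P)\<close> is a 2-cocycle; the conclusion says that it is the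
  coboundary of \<open>(\<chi>D; \<chi>E; 0)\<close>.\<close>

lemma HY2_trivial_imp_cocycle_splits:
  assumes "trivial_group (HY2 sD mD sE mE \<psi>)"
    and "\<And>c x. Vector_Spaces.linear sD sD (\<lambda>y. GD c x y)" "\<And>c y. Vector_Spaces.linear sD sD (\<lambda>x. GD c x y)"
    and "\<And>c x. Vector_Spaces.linear sE sE (\<lambda>y. GE c x y)" "\<And>c y. Vector_Spaces.linear sE sE (\<lambda>x. GE c x y)"
    and "Vector_Spaces.linear sD sE P"
    and D: "\<And>c c' e e' x y z. (c, c', e, e') \<in> dialgebra_laws \<Longrightarrow>
      mD c x (GD c' y z) + GD c x (mD c' y z) = mD e (GD e' x y) z + GD e (mD e' x y) z"
    and E: "\<And>c c' e e' x y z. (c, c', e, e') \<in> dialgebra_laws \<Longrightarrow>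
      mE c x (GE c' y z) + GE c x (mE c' y z) = mE e (GE e' x y) z + GE e (mE e' x y) z"
    and P: "\<And>c x y. \<psi> (GD c x y) - GE c (\<psi> x) (\<psi> y) = mE c (\<psi> x) (P y) - P (mD c x y) + mE c (P x) (\<psi> y)"
  obtains \<chi>D \<chi>E where "Vector_Spaces.linear sD sD \<chi>D" "Vector_Spaces.linear sE sE \<chi>E"
    "GD = coboundary mD \<chi>D" "GE = coboundary mE \<chi>E" "\<And>x. P x = \<psi> (\<chi>D x) - \<chi>E (\<psi> x)"
proof -
  \<comment> \<open>The third component of the cocycle condition, a restatement of
    \<open>P\<close>.\<close>
  have "(\<lambda>y as. \<psi> (cochain2 GD y as)) - (\<lambda>y as. cochain2 GE y (map \<psi> as))
      = cobd mD (\<lambda>c a e. mE c (\<psi> a) e) (\<lambda>c e a. mE c e (\<psi> a)) 1 (cochain1 P)"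
    unfolding cobd_1
  proof (rule cochain2_eqI)
    show "((\<lambda>y as. \<psi> (cochain2 GD y as)) - (\<lambda>y as. cochain2 GE y (map \<psi> as))) y as = 0"
      if "y \<notin> Y 2 \<or> length as \<noteq> 2" for y as
      using that by (auto simp: cochain2_def)
  qed (simp add: cochain2_apply cochain1_apply P)
  then have "(cochain2 GD, cochain2 GE, cochain1 P) \<in> Z2_mor sD mD sE mE \<psi>"
    using assms(2-6) cobd_2_cochain2_eq_0[of mD GD, OF D] cobd_2_cochain2_eq_0[of mE GE, OF E]
    by (simp add: Z2_mor_def CYmor_def cochain2_in_CY cochain1_in_CY[simplified] zero_prod_def)
  then have "(cochain2 GD, cochain2 GE, cochain1 P) \<in> B2_mor sD mD sE mE \<psi>"
    using HY2_trivial_imp_coboundary[OF assms(1) zero_in_B2_mor] by blast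
  then obtain f g e where f: "f \<in> CY sD sD 1" and g: "g \<in> CY sE sE 1"
    and eq: "(cochain2 GD, cochain2 GE, cochain1 P) = cobd_mor mD mE \<psi> 1 (f, g, e)"
    by (auto simp: B2_mor_def CYmor_def)
  define \<chi>D where "\<chi>D = (\<lambda>a. f (Graft Bar Bar) [a])"
  define \<chi> where "\<chi> = (\<lambda>a. g (Graft Bar Bar) [a])"
  define u where "u = e Bar []"
  \<comment> \<open>The inner derivation added here, composed with \<psi>, is the coboundary of the
    0-cochain with value \<open>u\<close>. It turns the third component into
    \<open>\<psi> \<chi>D - \<chi>E \<psi>\<close> and leaves the second one unchanged.\<close>
  define \<chi>E where "\<chi>E = (\<lambda>a. \<chi> a + (mE LeftP a u - mE RightP u a))"
  show thesis
  proof
    show "Vector_Spaces.linear sD sD \<chi>D"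
      unfolding \<chi>D_def by (rule CY_1_linear[OF f])
    have "Vector_Spaces.linear sE sE \<chi>"
      unfolding \<chi>_def by (rule CY_1_linear[OF g])
    then show "Vector_Spaces.linear sE sE \<chi>E"
      unfolding \<chi>E_def using cod.mul_linear_left[of LeftP u] cod.mul_linear_right[of RightP u]
      unfolding module_hom_iff_linear[symmetric]
      by (intro module_pair.module_hom_add module_pair.module_hom_sub module_pair.intro cod.module_axioms)
    show "GD = coboundary mD \<chi>D"
      using eq unfolding cobd_mor_1 \<chi>D_def by (simp add: cochain2_inject)
    show "GE = coboundary mE \<chi>E"
      using eq unfolding cobd_mor_1 \<chi>E_def cod.coboundary_add_inner by (simp add: cochain2_inject \<chi>_def)
    have "cochain1 P = (\<lambda>y as. \<psi> (f y as) - g y (map \<psi> as))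
       - cochain1 (\<lambda>a. mE LeftP (\<psi> a) u - mE RightP u (\<psi> a))"
      using eq unfolding cobd_mor_1 u_def by simp
    then have "cochain1 P (Graft Bar Bar) [x] =
      \<psi> (\<chi>D x) - \<chi> (\<psi> x) - (mE LeftP (\<psi> x) u - mE RightP u (\<psi> x))" for x
      by (simp add: cochain1_apply \<chi>D_def \<chi>_def)
    then show "P x = \<psi> (\<chi>D x) - \<chi>E (\<psi> x)" for x
      by (simp add: cochain1_apply \<chi>E_def algebra_simps)
  qed
qed

end

subsection \<open>Power series of maps\<close>

definition constant_series :: "'f \<Rightarrow> nat \<Rightarrow> 'f::zero" where
  "constant_series f n = (if n = 0 then f else 0)"

text \<open>This and the next two definitions give the coefficients of
  \<open>\<Phi>\<^sub>t f\<^sub>t(a, b)\<close>, of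
  \<open>m(\<Phi>\<^sub>t a, \<Phi>\<^sub>t b)\<close> and of
  \<open>\<Phi>\<^sub>t \<Psi>\<^sub>t a\<close> for constant arguments.\<close>

definition compose_mul :: "(nat \<Rightarrow> 'a \<Rightarrow> 'b) \<Rightarrow> (nat \<Rightarrow> prodsort \<Rightarrow> 'a \<Rightarrow> 'a \<Rightarrow> 'a)
    \<Rightarrow> nat \<Rightarrow> prodsort \<Rightarrow> 'a \<Rightarrow> 'a \<Rightarrow> 'b::comm_monoid_add" where
  "compose_mul \<Phi> F N c a b = (\<Sum>i\<le>N. \<Phi> i (F (N - i) c a b))"

definition mul_compose :: "(prodsort \<Rightarrow> 'b \<Rightarrow> 'b \<Rightarrow> 'b) \<Rightarrow> (nat \<Rightarrow> 'a \<Rightarrow> 'b)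
    \<Rightarrow> nat \<Rightarrow> prodsort \<Rightarrow> 'a \<Rightarrow> 'a \<Rightarrow> 'b::comm_monoid_add" where
  "mul_compose m \<Phi> N c a b = (\<Sum>i\<le>N. m c (\<Phi> i a) (\<Phi> (N - i) b))"

definition compose_series :: "(nat \<Rightarrow> 'b \<Rightarrow> 'm) \<Rightarrow> (nat \<Rightarrow> 'a \<Rightarrow> 'b) \<Rightarrow> nat \<Rightarrow> 'a \<Rightarrow> 'm::comm_monoid_add" where
  "compose_series \<Phi> \<Psi> N a = (\<Sum>i\<le>N. \<Phi> i (\<Psi> (N - i) a))"

abbreviation const_mul :: "(prodsort \<Rightarrow> 'a \<Rightarrow> 'a \<Rightarrow> 'a) \<Rightarrow> prodsort \<Rightarrow> 'a fps \<Rightarrow> 'a fps \<Rightarrow> 'a::ab_group_add fps" where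
  "const_mul m \<equiv> fps_mul (constant_series m)"

lemma trivial_deformation_eq:
  "trivial_deformation mD mE \<psi> = (constant_series mD, constant_series mE, constant_series \<psi>)"
  by (auto simp: trivial_deformation_def constant_series_def fun_eq_iff)

lemma fps_apply_nth: "fps_nth (fps_apply \<Phi> a) N = (\<Sum>n\<le>N. \<Phi> n (fps_nth a (N - n)))"
  by (simp add: fps_apply_def)

lemma fps_mul_nth:
  "fps_nth (fps_mul F c a b) N = (\<Sum>(n, i, j) \<in> {(n, i, j). n + i + j = N}. F n c (fps_nth a i) (fps_nth b j))"
  by (simp add: fps_mul_def)

lemma const_mul_nth: "fps_nth (const_mul m c a b) N = (\<Sum>i\<le>N. m c (fps_nth a i) (fps_nth b (N - i)))"
proof -
  have "fps_nth (const_mul m c a b) N =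
      (\<Sum>(n, i, j) \<in> (\<lambda>i. (0, i, N - i)) ` {..N}. constant_series m n c (fps_nth a i) (fps_nth b j))"
    unfolding fps_mul_nth
    by (rule sum.mono_neutral_right)
      (auto simp: constant_series_def finite_fps_mul_index image_iff)
  also have "\<dots> = (\<Sum>i\<le>N. m c (fps_nth a i) (fps_nth b (N - i)))"
    by (subst sum.reindex) (auto simp: inj_on_def constant_series_def)
  finally show ?thesis .
qed

lemma fps_apply_constant_series_nth: "fps_nth (fps_apply (constant_series f) a) N = f (fps_nth a N)"
proof -
  have "(\<Sum>n\<le>N. constant_series f n (fps_nth a (N - n))) = (\<Sum>n\<in>{0}. constant_series f n (fps_nth a (N - n)))"
    by (rule sum.mono_neutral_right) (auto simp: constant_series_def)
  then show ?thesis by (simp add: fps_apply_nth constant_series_def)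
qed

lemma const_mul_fps_const:
  assumes "biadditive m"
  shows "const_mul m c (fps_const a) (fps_const b) = Abs_fps (\<lambda>n. constant_series m n c a b)"
proof (rule fps_ext)
  fix n
  have "(\<Sum>i\<le>n. m c (fps_nth (fps_const a) i) (fps_nth (fps_const b) (n - i)))
      = (\<Sum>i\<in>{0}. m c (fps_nth (fps_const a) i) (fps_nth (fps_const b) (n - i)))"
    by (rule sum.mono_neutral_right) (auto simp: biadditiveD[OF assms])
  then show "fps_nth (const_mul m c (fps_const a) (fps_const b)) n =
      fps_nth (Abs_fps (\<lambda>n. constant_series m n c a b)) n"
    by (auto simp: const_mul_nth constant_series_def biadditiveD[OF assms])
qed

section \<open>Constant and lowest-order coefficients\<close>

lemma fps_mul_fps_const_nth_0: "fps_nth (fps_mul F c a b) 0 = F 0 c (fps_nth a 0) (fps_nth b 0)"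
proof -
  have "{(n, i, j). n + i + j = (0::nat)} = {(0, 0, 0)}" by auto
  then show ?thesis by (simp add: fps_mul_nth)
qed

text \<open>A series of order at least \<open>N\<close> sees only the constant terms of its
  arguments at order \<open>N\<close>. Applied to defects, this isolates the first one that may be
  nonzero.\<close>

lemma fps_mul_nth_low:
  assumes "\<And>k. k < N \<Longrightarrow> H k = (\<lambda>c a b. 0)"
  shows "k < N \<Longrightarrow> fps_nth (fps_mul H c a b) k = 0"
    and "fps_nth (fps_mul H c a b) N = H N c (fps_nth a 0) (fps_nth b 0)"
proof -
  show "fps_nth (fps_mul H c a b) k = 0" if "k < N"
    unfolding fps_mul_nth using that by (intro sum.neutral) (auto simp: assms)
  have "fps_nth (fps_mul H c a b) N = (\<Sum>(n, i, j) \<in> {(N, 0, 0)}. H n c (fps_nth a i) (fps_nth b j))"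
    unfolding fps_mul_nth
  proof (rule sum.mono_neutral_right)
    show "\<forall>p\<in>{(n, i, j). n + i + j = N} - {(N, 0, 0)}.
        (case p of (n, i, j) \<Rightarrow> H n c (fps_nth a i) (fps_nth b j)) = 0"
    proof
      fix p assume p: "p \<in> {(n, i, j). n + i + j = N} - {(N, 0, 0)}"
      obtain n i j where "p = (n, i, j)" by (rule prod_cases3)
      with p show "(case p of (n, i, j) \<Rightarrow> H n c (fps_nth a i) (fps_nth b j)) = 0"
        \<comment> \<open>If \<open>n < N\<close>, the coefficient vanishes; otherwise
          \<open>n + i + j = N\<close> forces the excluded triple.\<close>
        by (cases "n < N") (auto simp: assms)
    qed
  qed (auto simp: finite_fps_mul_index)
  then show "fps_nth (fps_mul H c a b) N = H N c (fps_nth a 0) (fps_nth b 0)" by simp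
qed

lemma fps_apply_nth_low:
  assumes "\<And>k. k < N \<Longrightarrow> H k = (\<lambda>a. 0)"
  shows "k < N \<Longrightarrow> fps_nth (fps_apply H a) k = 0"
    and "fps_nth (fps_apply H a) N = H N (fps_nth a 0)"
proof -
  show "fps_nth (fps_apply H a) k = 0" if "k < N"
    using that by (simp add: fps_apply_nth assms)
  have "(\<Sum>n\<le>N. H n (fps_nth a (N - n))) = (\<Sum>n\<in>{N}. H n (fps_nth a (N - n)))"
    by (rule sum.mono_neutral_right) (auto simp: assms)
  then show "fps_nth (fps_apply H a) N = H N (fps_nth a 0)"
    by (simp add: fps_apply_nth)
qed

lemma const_mul_nth_low:
  assumes "biadditive m" "\<And>k. k < N \<Longrightarrow> fps_nth d k = 0"
  shows "fps_nth (const_mul m c a d) N = m c (fps_nth a 0) (fps_nth d N)"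
    and "fps_nth (const_mul m c d a) N = m c (fps_nth d N) (fps_nth a 0)"
proof -
  have "(\<Sum>i\<le>N. m c (fps_nth a i) (fps_nth d (N - i))) = (\<Sum>i\<in>{0}. m c (fps_nth a i) (fps_nth d (N - i)))"
    by (rule sum.mono_neutral_right) (auto simp: assms biadditiveD[OF assms(1)])
  then show "fps_nth (const_mul m c a d) N = m c (fps_nth a 0) (fps_nth d N)"
    by (simp add: const_mul_nth)
  have "(\<Sum>i\<le>N. m c (fps_nth d i) (fps_nth a (N - i))) = (\<Sum>i\<in>{N}. m c (fps_nth d i) (fps_nth a (N - i)))"
    by (rule sum.mono_neutral_right) (auto simp: assms biadditiveD[OF assms(1)])
  then show "fps_nth (const_mul m c d a) N = m c (fps_nth d N) (fps_nth a 0)"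
    by (simp add: const_mul_nth)
qed

section \<open>Identities between series of maps and products\<close>

lemma biadditive_const_mul:
  assumes "biadditive m"
  shows "biadditive (const_mul m)"
  unfolding biadditive_def additive_def
  by (auto intro!: fps_ext simp: const_mul_nth biadditiveD[OF assms] sum.distrib)

lemma additive_fps_apply:
  assumes "\<And>n. additive (\<Phi> n)"
  shows "additive (fps_apply \<Phi>)"
  unfolding additive_def
  by (auto intro!: fps_ext simp: fps_apply_nth additive.add[OF assms] sum.distrib)

text \<open>The argument for associativity of the Cauchy product, with the law applied to each
  summand.\<close>

lemma const_mul_assoc:
  assumes m: "biadditive m" and law: "\<And>x y z. m c x (m c' y z) = m e (m e' x y) z"
  shows "const_mul m c x (const_mul m c' y z) = const_mul m e (const_mul m e' x y) z"
proof (rule fps_ext)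
  fix N
  let ?f = "\<lambda>i j k. m c (fps_nth x i) (m c' (fps_nth y j) (fps_nth z k))"
  have "fps_nth (const_mul m c x (const_mul m c' y z)) N = (\<Sum>j=0..N. \<Sum>i=0..N-j. ?f j i (N - j - i))"
    by (simp add: const_mul_nth biadditiveD[OF m] atLeast0AtMost)
  also have "\<dots> = (\<Sum>j=0..N. \<Sum>i=0..j. ?f i (j - i) (N - j))"
    by (rule fps_mult_assoc_lemma[symmetric])
  also have "\<dots> = fps_nth (const_mul m e (const_mul m e' x y) z) N"
    by (simp add: const_mul_nth biadditiveD[OF m] atLeast0AtMost law)
  finally show "fps_nth (const_mul m c x (const_mul m c' y z)) N =
      fps_nth (const_mul m e (const_mul m e' x y) z) N" .
qed

lemma fps_apply_constant_series_const_mul: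
  assumes "additive \<psi>" "\<And>c x y. \<psi> (m c x y) = m' c (\<psi> x) (\<psi> y)"
  shows "fps_apply (constant_series \<psi>) (const_mul m c x y)
    = const_mul m' c (fps_apply (constant_series \<psi>) x) (fps_apply (constant_series \<psi>) y)"
  by (rule fps_ext)
    (simp add: fps_apply_constant_series_nth const_mul_nth additive.sum[OF assms(1)] assms(2))

lemma fps_apply_fps_apply:
  assumes "\<And>n. additive (\<Phi> n)"
  shows "fps_apply \<Phi> (fps_apply \<Psi> x) = fps_apply (compose_series \<Phi> \<Psi>) x"
proof (rule fps_ext)
  fix N
  have "fps_nth (fps_apply \<Phi> (fps_apply \<Psi> x)) N = (\<Sum>j=0..N. \<Sum>i=0..N-j. \<Phi> j (\<Psi> i (fps_nth x (N - j - i))))"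
    by (simp add: fps_apply_nth additive.sum[OF assms] atLeast0AtMost)
  also have "\<dots> = (\<Sum>j=0..N. \<Sum>i=0..j. \<Phi> i (\<Psi> (j - i) (fps_nth x (N - j))))"
    by (rule fps_mult_assoc_lemma[symmetric])
  also have "\<dots> = fps_nth (fps_apply (compose_series \<Phi> \<Psi>) x) N"
    by (simp add: fps_apply_nth compose_series_def atLeast0AtMost)
  finally show "fps_nth (fps_apply \<Phi> (fps_apply \<Psi> x)) N =
      fps_nth (fps_apply (compose_series \<Phi> \<Psi>) x) N" .
qed

lemma fps_apply_fps_mul:
  assumes "\<And>n. additive (\<Phi> n)"
  shows "fps_apply \<Phi> (fps_mul F c x y) = fps_mul (compose_mul \<Phi> F) c x y"
proof (rule fps_ext)
  fix N
  let ?I = "\<lambda>N. {(n, i, j). n + i + j = (N::nat)}"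
  have "fps_nth (fps_apply \<Phi> (fps_mul F c x y)) N =
      (\<Sum>(p, n, i, j) \<in> (SIGMA p:{..N}. ?I (N - p)). \<Phi> p (F n c (fps_nth x i) (fps_nth y j)))"
    by (simp add: fps_apply_nth fps_mul_nth additive.sum[OF assms] case_prod_unfold
        sum.Sigma finite_fps_mul_index[simplified case_prod_unfold])
  also have "\<dots> = (\<Sum>((k, i, j), p) \<in> (SIGMA (k, i, j):?I N. {..k}).
      \<Phi> p (F (k - p) c (fps_nth x i) (fps_nth y j)))"
    \<comment> \<open>Terms are regrouped by \<open>k = n + p\<close>, the degree contributed by the
      two coefficient maps together.\<close>
    by (rule sum.reindex_bij_witness[where i = "\<lambda>((k, i, j), p). (p, k - p, i, j)"
          and j = "\<lambda>(p, n, i, j). ((n + p, i, j), p)"]) auto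
  also have "\<dots> = fps_nth (fps_mul (compose_mul \<Phi> F) c x y) N"
    by (simp add: fps_mul_nth compose_mul_def case_prod_unfold
        sum.Sigma finite_fps_mul_index[simplified case_prod_unfold])
  finally show "fps_nth (fps_apply \<Phi> (fps_mul F c x y)) N =
      fps_nth (fps_mul (compose_mul \<Phi> F) c x y) N" .
qed

lemma const_mul_fps_apply:
  assumes m: "biadditive m"
  shows "const_mul m c (fps_apply \<Phi> x) (fps_apply \<Phi> y) = fps_mul (mul_compose m \<Phi>) c x y"
proof (rule fps_ext)
  fix N
  let ?I = "\<lambda>N. {(n, i, j). n + i + j = (N::nat)}"
  have "fps_nth (const_mul m c (fps_apply \<Phi> x) (fps_apply \<Phi> y)) N =
      (\<Sum>(l, q, p) \<in> (SIGMA l:{..N}. {..N-l} \<times> {..l}).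
        m c (\<Phi> p (fps_nth x (l - p))) (\<Phi> q (fps_nth y (N - l - q))))"
    by (simp add: const_mul_nth fps_apply_nth biadditiveD[OF m] sum.Sigma sum.cartesian_product case_prod_unfold)
  also have "\<dots> = (\<Sum>((k, i, j), p) \<in> (SIGMA (k, i, j):?I N. {..k}).
      m c (\<Phi> p (fps_nth x i)) (\<Phi> (k - p) (fps_nth y j)))"
    \<comment> \<open>Here \<open>k = p + q\<close> collects the degrees of the two maps, and
      \<open>l = i + p\<close> is the degree of the left factor.\<close>
    by (rule sum.reindex_bij_witness[where i = "\<lambda>((k, i, j), p). (i + p, k - p, p)"
          and j = "\<lambda>(l, q, p). ((p + q, l - p, N - l - q), p)"]) auto
  also have "\<dots> = fps_nth (fps_mul (mul_compose m \<Phi>) c x y) N"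
    by (simp add: fps_mul_nth mul_compose_def case_prod_unfold
        sum.Sigma finite_fps_mul_index[simplified case_prod_unfold])
  finally show "fps_nth (const_mul m c (fps_apply \<Phi> x) (fps_apply \<Phi> y)) N =
      fps_nth (fps_mul (mul_compose m \<Phi>) c x y) N" .
qed

section \<open>Defects of the products and of the morphism\<close>

text \<open>The coefficient of order \<open>N\<close> of \<open>\<Phi>\<^sub>t f\<^sub>t(a, b) -
  m(\<Phi>\<^sub>t a, \<Phi>\<^sub>t b)\<close>.\<close>

definition mul_defect where
  "mul_defect m \<Phi> F N c a b = compose_mul \<Phi> F N c a b - mul_compose m \<Phi> N c a b"

text \<open>The coefficient of order \<open>N\<close> of
  \<open>\<Phi>\<^sub>E \<Psi>\<^sub>t a - \<psi> \<Phi>\<^sub>D a\<close>.\<close>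

definition hom_defect where
  "hom_defect \<psi> \<Phi>D \<Phi>E \<Psi> N a = compose_series \<Phi>E \<Psi> N a - \<psi> (\<Phi>D N a)"

text \<open>All defects together form an error term, so that nested products can be expanded as
  power series before comparing coefficients.\<close>

lemma fps_apply_fps_mul_defect:
  assumes "\<And>n. additive (\<Phi> n)" and "biadditive m"
  shows "fps_apply \<Phi> (fps_mul F c x y) =
    const_mul m c (fps_apply \<Phi> x) (fps_apply \<Phi> y) + fps_mul (mul_defect m \<Phi> F) c x y"
  unfolding fps_apply_fps_mul[OF assms(1)] const_mul_fps_apply[OF assms(2)]
  by (rule fps_ext) (simp add: fps_mul_nth mul_defect_def case_prod_unfold sum_subtractf)

lemma fps_apply_hom_defect:
  assumes "\<And>n. additive (\<Phi>E n)" and "additive \<psi>"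
  shows "fps_apply \<Phi>E (fps_apply \<Psi> x) =
    fps_apply (constant_series \<psi>) (fps_apply \<Phi>D x) + fps_apply (hom_defect \<psi> \<Phi>D \<Phi>E \<Psi>) x"
proof (rule fps_ext)
  show "fps_nth (fps_apply \<Phi>E (fps_apply \<Psi> x)) N =
      fps_nth (fps_apply (constant_series \<psi>) (fps_apply \<Phi>D x) + fps_apply (hom_defect \<psi> \<Phi>D \<Phi>E \<Psi>) x) N" for N
    unfolding fps_apply_fps_apply[OF assms(1)] fps_add_nth fps_apply_constant_series_nth
    by (simp add: fps_apply_nth hom_defect_def sum_subtractf additive.sum[OF assms(2)])
qed

subsection \<open>The lowest-order defect is a cocycle\<close>

text \<open>At order \<open>N\<close> the new summand \<chi> meets only coefficients of order 0,
  that is, \<open>m\<close> and the identity. The three resulting terms make up the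
  coboundary.\<close>

lemma mul_defect_update:
  assumes m: "biadditive m" and \<Phi>: "\<Phi> 0 = id" and F: "F 0 = m" and N: "N > 0"
  shows "mul_defect m (\<Phi>(N := \<lambda>x. \<Phi> N x + \<chi> x)) F N c a b = mul_defect m \<Phi> F N c a b - coboundary m \<chi> c a b"
proof -
  let ?\<Phi> = "\<Phi>(N := \<lambda>x. \<Phi> N x + \<chi> x)"
  have "compose_mul ?\<Phi> F N c a b = (\<Sum>i\<le>N. \<Phi> i (F (N - i) c a b) + (if i = N then \<chi> (m c a b) else 0))"
    unfolding compose_mul_def by (rule sum.cong) (auto simp: F)
  also have "\<dots> = compose_mul \<Phi> F N c a b + \<chi> (m c a b)"
    by (simp add: sum.distrib compose_mul_def)
  finally have 1: "compose_mul ?\<Phi> F N c a b = compose_mul \<Phi> F N c a b + \<chi> (m c a b)" .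
  have "mul_compose m ?\<Phi> N c a b = (\<Sum>i\<le>N. m c (\<Phi> i a) (\<Phi> (N - i) b)
      + (if i = N then m c (\<chi> a) b else 0) + (if i = 0 then m c a (\<chi> b) else 0))"
    \<comment> \<open>Since \<open>N > 0\<close>, the end terms \<open>i = N\<close> and
      \<open>i = 0\<close> are distinct and \<open>\<Phi> 0\<close> is still the identity.\<close>
    unfolding mul_compose_def using N by (intro sum.cong) (auto simp: \<Phi> biadditiveD[OF m])
  also have "\<dots> = mul_compose m \<Phi> N c a b + m c (\<chi> a) b + m c a (\<chi> b)"
    by (simp add: sum.distrib mul_compose_def)
  finally show ?thesis
    unfolding mul_defect_def 1 coboundary_def by (simp add: algebra_simps)
qed

lemma hom_defect_update:
  assumes "additive \<psi>" and \<Psi>: "\<Psi> 0 = \<psi>"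
  shows "hom_defect \<psi> (\<Phi>D(N := \<lambda>x. \<Phi>D N x + \<chi>D x)) (\<Phi>E(N := \<lambda>x. \<Phi>E N x + \<chi>E x)) \<Psi> N a
    = hom_defect \<psi> \<Phi>D \<Phi>E \<Psi> N a - (\<psi> (\<chi>D a) - \<chi>E (\<psi> a))"
proof -
  have "compose_series (\<Phi>E(N := \<lambda>x. \<Phi>E N x + \<chi>E x)) \<Psi> N a
      = (\<Sum>i\<le>N. \<Phi>E i (\<Psi> (N - i) a) + (if i = N then \<chi>E (\<psi> a) else 0))"
    unfolding compose_series_def by (rule sum.cong) (auto simp: \<Psi>)
  also have "\<dots> = compose_series \<Phi>E \<Psi> N a + \<chi>E (\<psi> a)"
    by (simp add: sum.distrib compose_series_def)
  finally show ?thesis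
    by (simp add: hom_defect_def additive.add[OF assms(1)])
qed

text \<open>Ensures that correcting a coefficient leaves the defects of lower order at zero.\<close>

lemma mul_defect_cong:
  assumes "\<And>i. i \<le> N \<Longrightarrow> \<Phi> i = \<Phi>' i"
  shows "mul_defect m \<Phi> F N = mul_defect m \<Phi>' F N"
  using assms by (auto simp: fun_eq_iff mul_defect_def compose_mul_def mul_compose_def
      intro!: arg_cong2[where f=minus] sum.cong)

lemma hom_defect_cong:
  assumes "\<And>i. i \<le> N \<Longrightarrow> \<Phi>D i = \<Phi>D' i" "\<And>i. i \<le> N \<Longrightarrow> \<Phi>E i = \<Phi>E' i"
  shows "hom_defect \<psi> \<Phi>D \<Phi>E \<Psi> N = hom_defect \<psi> \<Phi>D' \<Phi>E' \<Psi> N"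
  using assms by (auto simp: fun_eq_iff hom_defect_def compose_series_def
      intro!: arg_cong2[where f=minus] sum.cong)

text \<open>Moving \<open>\<Phi>\<close> inside both bracketings produces equal triple products for
  \<open>m\<close> and, at order \<open>N\<close>, two terms with a single defect on each side;
  these are the four terms of the linearised law.\<close>

lemma mul_defect_cocycle:
  assumes m: "biadditive m" and law: "\<And>x y z. m c x (m c' y z) = m e (m e' x y) z"
    and \<Phi>: "\<And>n. additive (\<Phi> n)" "\<Phi> 0 = id"
    and F: "F 0 = m" "\<And>x y z. fps_mul F c x (fps_mul F c' y z) = fps_mul F e (fps_mul F e' x y) z"
    and low: "\<And>k. k < N \<Longrightarrow> mul_defect m \<Phi> F k = (\<lambda>c a b. 0)"
  defines "G \<equiv> mul_defect m \<Phi> F N"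
  shows "m c x (G c' y z) + G c x (m c' y z) = m e (G e' x y) z + G e (m e' x y) z"
proof -
  define A where "A = fps_apply \<Phi>"
  define H where "H = fps_mul (mul_defect m \<Phi> F)"
  note bm = biadditiveD[OF biadditive_const_mul[OF m]]
  have A: "A (fps_mul F c x y) = const_mul m c (A x) (A y) + H c x y" for c x y
    unfolding A_def H_def by (rule fps_apply_fps_mul_defect[OF \<Phi>(1) m])
  have A0: "fps_nth (A x) 0 = fps_nth x 0" for x
    by (simp add: A_def fps_apply_nth \<Phi>(2))
  have H: "fps_nth (H c x y) k = 0" if "k < N" for c x y k
    unfolding H_def by (rule fps_mul_nth_low(1)[OF low that])
  have HN: "fps_nth (H c x y) N = G c (fps_nth x 0) (fps_nth y 0)" for c x y
    unfolding H_def G_def by (rule fps_mul_nth_low(2)[OF low])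
  let ?x = "fps_const x" and ?y = "fps_const y" and ?z = "fps_const z"
  let ?L = "const_mul m c (A ?x) (const_mul m c' (A ?y) (A ?z))"
  \<comment> \<open>The last term is the outer defect: it sees only the constant term of the inner
    product, which is \<open>m c' y z\<close>.\<close>
  have "fps_nth (A (fps_mul F c ?x (fps_mul F c' ?y ?z))) N
      = fps_nth ?L N + m c x (G c' y z) + G c x (m c' y z)"
    by (simp add: A bm const_mul_nth_low[OF m H] HN A0 fps_mul_fps_const_nth_0 F(1))
  moreover have "fps_nth (A (fps_mul F e (fps_mul F e' ?x ?y) ?z)) N
      = fps_nth ?L N + m e (G e' x y) z + G e (m e' x y) z"
    by (simp add: A bm const_mul_nth_low[OF m H] HN A0 fps_mul_fps_const_nth_0 F(1)
        const_mul_assoc[where m=m, OF m law])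
  ultimately show ?thesis by (simp add: F(2) add.assoc)
qed

text \<open>\<open>\<Phi>\<^sub>E \<Psi>\<^sub>t\<close> of a product is computed in two ways:
  through the product of \<open>E\<close>, or through \<open>\<psi> \<Phi>\<^sub>D\<close> and the
  product of \<open>D\<close>. Order \<open>N\<close> of the comparison is the third cocycle
  equation.\<close>

lemma hom_defect_cocycle:
  assumes mD: "biadditive mD" and mE: "biadditive mE"
    and \<psi>: "additive \<psi>" "\<And>c x y. \<psi> (mD c x y) = mE c (\<psi> x) (\<psi> y)"
    and \<Phi>D: "\<And>n. additive (\<Phi>D n)" "\<Phi>D 0 = id" and \<Phi>E: "\<And>n. additive (\<Phi>E n)" "\<Phi>E 0 = id"
    and F: "FD 0 = mD" "\<Psi> 0 = \<psi>"
    and hom: "\<And>x y. fps_apply \<Psi> (fps_mul FD c x y) = fps_mul FE c (fps_apply \<Psi> x) (fps_apply \<Psi> y)"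
    and lowD: "\<And>k. k < N \<Longrightarrow> mul_defect mD \<Phi>D FD k = (\<lambda>c a b. 0)"
    and lowE: "\<And>k. k < N \<Longrightarrow> mul_defect mE \<Phi>E FE k = (\<lambda>c a b. 0)"
    and low: "\<And>k. k < N \<Longrightarrow> hom_defect \<psi> \<Phi>D \<Phi>E \<Psi> k = (\<lambda>a. 0)"
  defines "P \<equiv> hom_defect \<psi> \<Phi>D \<Phi>E \<Psi> N"
  shows "\<psi> (mul_defect mD \<Phi>D FD N c x y) - mul_defect mE \<Phi>E FE N c (\<psi> x) (\<psi> y)
    = mE c (\<psi> x) (P y) - P (mD c x y) + mE c (P x) (\<psi> y)"
proof -
  define A where "A = fps_apply \<Phi>D"
  define B where "B = fps_apply \<Phi>E"
  define S where "S = fps_apply \<Psi>"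
  define T where "T = fps_apply (constant_series \<psi>)"
  define HD where "HD = fps_mul (mul_defect mD \<Phi>D FD)"
  define HE where "HE = fps_mul (mul_defect mE \<Phi>E FE)"
  define K where "K = fps_apply (hom_defect \<psi> \<Phi>D \<Phi>E \<Psi>)"
  note bm = biadditiveD[OF biadditive_const_mul[OF mE]]
  have A: "A (fps_mul FD c x y) = const_mul mD c (A x) (A y) + HD c x y" for x y
    unfolding A_def HD_def by (rule fps_apply_fps_mul_defect[OF \<Phi>D(1) mD])
  have B: "B (fps_mul FE c x y) = const_mul mE c (B x) (B y) + HE c x y" for x y
    unfolding B_def HE_def by (rule fps_apply_fps_mul_defect[OF \<Phi>E(1) mE])
  have BS: "B (S x) = T (A x) + K x" for x
    unfolding B_def S_def T_def A_def K_def by (rule fps_apply_hom_defect[OF \<Phi>E(1) \<psi>(1)])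
  have T: "T (const_mul mD c x y) = const_mul mE c (T x) (T y)" for x y
    unfolding T_def by (rule fps_apply_constant_series_const_mul[where m=mD and m'=mE, OF \<psi>])
  have T_add: "T (x + y) = T x + T y" for x y
    unfolding T_def constant_series_def
    by (rule additive.add[OF additive_fps_apply]) (auto simp: additive_def additive.add[OF \<psi>(1)])
  have TN: "fps_nth (T x) k = \<psi> (fps_nth x k)" for x k
    by (simp add: T_def fps_apply_constant_series_nth)
  have A0: "fps_nth (A x) 0 = fps_nth x 0" and B0: "fps_nth (B x') 0 = fps_nth x' 0"
    and S0: "fps_nth (S x) 0 = \<psi> (fps_nth x 0)" for x x'
    by (simp_all add: A_def B_def S_def fps_apply_nth \<Phi>D(2) \<Phi>E(2) F)
  have HDN: "fps_nth (HD c x y) N = mul_defect mD \<Phi>D FD N c (fps_nth x 0) (fps_nth y 0)" for x y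
    unfolding HD_def by (rule fps_mul_nth_low(2)[OF lowD])
  have HEN: "fps_nth (HE c x y) N = mul_defect mE \<Phi>E FE N c (fps_nth x 0) (fps_nth y 0)" for x y
    unfolding HE_def by (rule fps_mul_nth_low(2)[OF lowE])
  have KN: "fps_nth (K x) N = P (fps_nth x 0)" for x
    unfolding K_def P_def by (rule fps_apply_nth_low(2)[OF low])
  have K: "fps_nth (K x) k = 0" if "k < N" for x k
    unfolding K_def by (rule fps_apply_nth_low(1)[OF low that])
  let ?x = "fps_const x" and ?y = "fps_const y"
  let ?L = "const_mul mE c (T (A ?x)) (T (A ?y))"
  \<comment> \<open>Only the left factor of the last term is split, so no product of two errors has
    to be evaluated separately.\<close>
  have "const_mul mE c (B (S ?x)) (B (S ?y)) =
      ?L + const_mul mE c (T (A ?x)) (K ?y) + const_mul mE c (K ?x) (B (S ?y))"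
    by (simp add: BS bm add.assoc)
  then have "fps_nth (B (fps_mul FE c (S ?x) (S ?y))) N
      = fps_nth ?L N + mE c (\<psi> x) (P y) + mE c (P x) (\<psi> y) + mul_defect mE \<Phi>E FE N c (\<psi> x) (\<psi> y)"
    by (simp add: B const_mul_nth_low[OF mE K] HEN TN A0 B0 S0 KN)
  moreover have "fps_nth (B (S (fps_mul FD c ?x ?y))) N
      = fps_nth ?L N + \<psi> (mul_defect mD \<Phi>D FD N c x y) + P (mD c x y)"
    by (simp add: BS A T T_add TN HDN KN fps_mul_fps_const_nth_0 F(1))
  moreover have "S (fps_mul FD c ?x ?y) = fps_mul FE c (S ?x) (S ?y)"
    by (simp add: S_def hom)
  ultimately have "\<psi> (mul_defect mD \<Phi>D FD N c x y) + P (mD c x y)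
      = mE c (\<psi> x) (P y) + mE c (P x) (\<psi> y) + mul_defect mE \<Phi>E FE N c (\<psi> x) (\<psi> y)"
    by (simp add: add.assoc)
  then show ?thesis by (simp add: algebra_simps)
qed

subsection \<open>Rigidity\<close>

lemma linear_diff:
  assumes "Vector_Spaces.linear s s' f" "Vector_Spaces.linear s s' g"
  shows "Vector_Spaces.linear s s' (\<lambda>x. f x - g x)"
proof -
  interpret f: Vector_Spaces.linear s s' f by fact
  interpret g: Vector_Spaces.linear s s' g by fact
  show ?thesis
    by unfold_locales (simp_all add: f.add g.add f.scale g.scale f.vs2.scale_right_diff_distrib)
qed

lemma linear_add:
  assumes "Vector_Spaces.linear s s' f" "Vector_Spaces.linear s s' g"
  shows "Vector_Spaces.linear s s' (\<lambda>x. f x + g x)"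
proof -
  interpret f: Vector_Spaces.linear s s' f by fact
  interpret g: Vector_Spaces.linear s s' g by fact
  show ?thesis
    by unfold_locales (simp_all add: f.add g.add f.scale g.scale f.vs2.scale_right_distrib)
qed

text \<open>The first premise supplies the vector space structures, which the second does not
  provide for empty \<open>I\<close>.\<close>

lemma linear_sum:
  assumes "Vector_Spaces.linear s s' (f i)" "\<And>i. i \<in> I \<Longrightarrow> Vector_Spaces.linear s s' (f i)"
  shows "Vector_Spaces.linear s s' (\<lambda>x. \<Sum>i\<in>I. f i x)"
proof -
  interpret f: Vector_Spaces.linear s s' "f i" by fact
  interpret module_pair s s' by unfold_locales
  show ?thesis
    using assms(2) f.vs1.module_axioms f.vs2.module_axioms
    unfolding module_hom_iff_linear[symmetric] by (intro module_hom_sum conjI)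
qed

lemma linear_comp:
  assumes "Vector_Spaces.linear s s' f" "Vector_Spaces.linear s' s'' g"
  shows "Vector_Spaces.linear s s'' (\<lambda>x. g (f x))"
  using Vector_Spaces.linear_compose[OF assms] by (simp add: o_def)

lemma linear_mul_defect:
  assumes "\<And>n. Vector_Spaces.linear s s (\<Phi> n)"
    and "\<And>c x. Vector_Spaces.linear s s (\<lambda>y. m c x y)" "\<And>c y. Vector_Spaces.linear s s (\<lambda>x. m c x y)"
    and "\<And>n c x. Vector_Spaces.linear s s (\<lambda>y. F n c x y)" "\<And>n c y. Vector_Spaces.linear s s (\<lambda>x. F n c x y)"
  shows "Vector_Spaces.linear s s (\<lambda>y. mul_defect m \<Phi> F N c x y)"
    "Vector_Spaces.linear s s (\<lambda>x. mul_defect m \<Phi> F N c x y)"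
  unfolding mul_defect_def compose_mul_def mul_compose_def
  by (intro linear_diff linear_sum;
      rule linear_comp[OF assms(4) assms(1)] linear_comp[OF assms(5) assms(1)]
        linear_comp[OF assms(1) assms(2)] linear_comp[OF assms(1) assms(3)])+

lemma linear_hom_defect:
  assumes "\<And>n. Vector_Spaces.linear s s (\<Phi>D n)" "\<And>n. Vector_Spaces.linear s' s' (\<Phi>E n)"
    "\<And>n. Vector_Spaces.linear s s' (\<Psi> n)" "Vector_Spaces.linear s s' \<psi>"
  shows "Vector_Spaces.linear s s' (hom_defect \<psi> \<Phi>D \<Phi>E \<Psi> N)"
  unfolding hom_defect_def[abs_def] compose_series_def
  by (intro linear_diff linear_sum; rule linear_comp[OF assms(3) assms(2)] linear_comp[OF assms(1) assms(4)])

section \<open>Formal isomorphisms from vanishing defects\<close>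

lemma fps_apply_fps_apply_inv:
  assumes "\<Phi> 0 = id"
  shows "fps_apply \<Phi> (fps_apply_inv \<Phi> x) = x"
proof -
  have "bij (fps_apply \<Phi>)" using assms by (rule bij_fps_apply)
  then show ?thesis
    unfolding fps_apply_inv_def by (simp add: bij_def f_the_inv_into_f)
qed

text \<open>Without defects \<open>\<Phi>\<close> is multiplicative; the claim is this identity at
  \<open>\<Phi>\<close>-preimages of constants.\<close>

lemma formal_iso_constant_series:
  assumes "\<And>n. Vector_Spaces.linear s s (\<Phi> n)" "\<Phi> 0 = id" "biadditive m"
    and "\<And>n. mul_defect m \<Phi> F n = (\<lambda>c a b. 0)"
  shows "formal_iso s F (constant_series m) \<Phi>"
  unfolding formal_iso_def
proof (intro conjI allI)
  fix c a b
  have "fps_mul (mul_defect m \<Phi> F) c x y = 0" for x y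
    by (rule fps_ext) (simp add: fps_mul_nth assms(4))
  then show "Abs_fps (\<lambda>n. constant_series m n c a b) =
      fps_apply \<Phi> (fps_mul F c (fps_apply_inv \<Phi> (fps_const a)) (fps_apply_inv \<Phi> (fps_const b)))"
    using fps_apply_fps_mul_defect[OF linear_imp_additive[OF assms(1)] assms(3)]
    by (simp add: fps_apply_fps_apply_inv[where \<Phi>=\<Phi>, OF assms(2)] const_mul_fps_const[OF assms(3)])
qed (use assms in auto)

section \<open>Inductive construction of the trivialising series\<close>

context dialgebra_hom
begin

text \<open>Approximate solutions are full series: coefficients above \<open>n\<close> are
  constrained only by linearity.\<close>

definition trivializes_upto :: "('d, 'e) def_triple \<Rightarrow> nat \<Rightarrow> (nat \<Rightarrow> 'd \<Rightarrow> 'd) \<times> (nat \<Rightarrow> 'e \<Rightarrow> 'e) \<Rightarrow> bool" where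
  "trivializes_upto = (\<lambda>(FD, FE, \<Psi>) n (\<Phi>D, \<Phi>E).
     (\<forall>k. Vector_Spaces.linear sD sD (\<Phi>D k)) \<and> (\<forall>k. Vector_Spaces.linear sE sE (\<Phi>E k)) \<and>
     \<Phi>D 0 = id \<and> \<Phi>E 0 = id \<and>
     (\<forall>k\<le>n. mul_defect mD \<Phi>D FD k = (\<lambda>c a b. 0) \<and> mul_defect mE \<Phi>E FE k = (\<lambda>c a b. 0) \<and>
       hom_defect \<psi> \<Phi>D \<Phi>E \<Psi> k = (\<lambda>a. 0)))"

text \<open>At order 0 a deformation is the original structure, so the identity works.\<close>

lemma trivializes_upto_0:
  assumes "morphism_deformation sD mD sE mE \<psi> (FD, FE, \<Psi>)"
  shows "trivializes_upto (FD, FE, \<Psi>) 0 (constant_series id, constant_series id)"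
proof -
  have "FD 0 = mD" "FE 0 = mE" "\<Psi> 0 = \<psi>"
    using assms by (auto simp: dialgebra_deformation_def)
  moreover have "Vector_Spaces.linear sD sD (constant_series id k)" "Vector_Spaces.linear sE sE (constant_series id k)" for k
    using linear_zero_fun dom.linear_id cod.linear_id by (auto simp: constant_series_def zero_fun_def)
  ultimately show ?thesis
    by (auto simp: trivializes_upto_def constant_series_def mul_defect_def hom_defect_def
        compose_mul_def mul_compose_def compose_series_def fun_eq_iff)
qed

text \<open>The agreement clauses let the successive approximations converge
  coefficientwise.\<close>

lemma trivializes_upto_Suc:
  assumes "morphism_deformation sD mD sE mE \<psi> (FD, FE, \<Psi>)" and HY2: "trivial_group (HY2 sD mD sE mE \<psi>)"
    and triv: "trivializes_upto (FD, FE, \<Psi>) n (\<Phi>D, \<Phi>E)"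
  obtains \<Phi>D' \<Phi>E' where "trivializes_upto (FD, FE, \<Psi>) (Suc n) (\<Phi>D', \<Phi>E')"
    "\<And>k. k \<le> n \<Longrightarrow> \<Phi>D' k = \<Phi>D k" "\<And>k. k \<le> n \<Longrightarrow> \<Phi>E' k = \<Phi>E k"
proof -
  let ?N = "Suc n"
  have FD: "FD 0 = mD" "\<And>n c x. Vector_Spaces.linear sD sD (\<lambda>y. FD n c x y)"
      "\<And>n c y. Vector_Spaces.linear sD sD (\<lambda>x. FD n c x y)" "dialgebra (fps_scale sD) (fps_mul FD)"
    and FE: "FE 0 = mE" "\<And>n c x. Vector_Spaces.linear sE sE (\<lambda>y. FE n c x y)"
      "\<And>n c y. Vector_Spaces.linear sE sE (\<lambda>x. FE n c x y)" "dialgebra (fps_scale sE) (fps_mul FE)"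
    and \<Psi>: "\<Psi> 0 = \<psi>" "\<And>n. Vector_Spaces.linear sD sE (\<Psi> n)"
      "dialgebra_hom (fps_scale sD) (fps_mul FD) (fps_scale sE) (fps_mul FE) (fps_apply \<Psi>)"
    using assms(1) by (auto simp: dialgebra_deformation_def)
  have \<Phi>D: "\<And>k. Vector_Spaces.linear sD sD (\<Phi>D k)" "\<Phi>D 0 = id"
    and \<Phi>E: "\<And>k. Vector_Spaces.linear sE sE (\<Phi>E k)" "\<Phi>E 0 = id"
    and low: "\<And>k. k < ?N \<Longrightarrow> mul_defect mD \<Phi>D FD k = (\<lambda>c a b. 0)"
      "\<And>k. k < ?N \<Longrightarrow> mul_defect mE \<Phi>E FE k = (\<lambda>c a b. 0)"
      "\<And>k. k < ?N \<Longrightarrow> hom_defect \<psi> \<Phi>D \<Phi>E \<Psi> k = (\<lambda>a. 0)"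
    using triv by (auto simp: trivializes_upto_def less_Suc_eq_le)
  have add_\<psi>: "additive \<psi>" by (rule linear_imp_additive) unfold_locales
  note addD = linear_imp_additive[OF \<Phi>D(1)] and addE = linear_imp_additive[OF \<Phi>E(1)]
  have linD: "Vector_Spaces.linear sD sD (\<lambda>y. mul_defect mD \<Phi>D FD ?N c x y)"
      "Vector_Spaces.linear sD sD (\<lambda>x. mul_defect mD \<Phi>D FD ?N c x y)" for c x y
    by (rule linear_mul_defect[where m=mD and F=FD and \<Phi>=\<Phi>D];
      rule \<Phi>D dom.mul_linear_right dom.mul_linear_left FD(2,3))+
  have linE: "Vector_Spaces.linear sE sE (\<lambda>y. mul_defect mE \<Phi>E FE ?N c x y)"
      "Vector_Spaces.linear sE sE (\<lambda>x. mul_defect mE \<Phi>E FE ?N c x y)" for c x y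
    by (rule linear_mul_defect[where m=mE and F=FE and \<Phi>=\<Phi>E];
      rule \<Phi>E cod.mul_linear_right cod.mul_linear_left FE(2,3))+
  have linP: "Vector_Spaces.linear sD sE (hom_defect \<psi> \<Phi>D \<Phi>E \<Psi> ?N)"
    by (rule linear_hom_defect[OF \<Phi>D(1) \<Phi>E(1) \<Psi>(2)]) unfold_locales
  obtain \<chi>D \<chi>E where \<chi>: "Vector_Spaces.linear sD sD \<chi>D" "Vector_Spaces.linear sE sE \<chi>E"
    "mul_defect mD \<Phi>D FD ?N = coboundary mD \<chi>D" "mul_defect mE \<Phi>E FE ?N = coboundary mE \<chi>E"
    "\<And>x. hom_defect \<psi> \<Phi>D \<Phi>E \<Psi> ?N x = \<psi> (\<chi>D x) - \<chi>E (\<psi> x)"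
  proof (rule HY2_trivial_imp_cocycle_splits[OF HY2 linD linE linP])
    show "mD c x (mul_defect mD \<Phi>D FD ?N c' y z) + mul_defect mD \<Phi>D FD ?N c x (mD c' y z)
        = mD e (mul_defect mD \<Phi>D FD ?N e' x y) z + mul_defect mD \<Phi>D FD ?N e (mD e' x y) z"
      if "(c, c', e, e') \<in> dialgebra_laws" for c c' e e' x y z
      by (rule mul_defect_cocycle[where m=mD and \<Phi>=\<Phi>D and F=FD,
            OF dom.biadditive_mul dom.mul_law[OF that] addD \<Phi>D(2) FD(1)
            dialgebra.mul_law[OF FD(4) that] low(1)])
    show "mE c x (mul_defect mE \<Phi>E FE ?N c' y z) + mul_defect mE \<Phi>E FE ?N c x (mE c' y z)
        = mE e (mul_defect mE \<Phi>E FE ?N e' x y) z + mul_defect mE \<Phi>E FE ?N e (mE e' x y) z"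
      if "(c, c', e, e') \<in> dialgebra_laws" for c c' e e' x y z
      by (rule mul_defect_cocycle[where m=mE and \<Phi>=\<Phi>E and F=FE,
            OF cod.biadditive_mul cod.mul_law[OF that] addE \<Phi>E(2) FE(1)
            dialgebra.mul_law[OF FE(4) that] low(2)])
    show "\<psi> (mul_defect mD \<Phi>D FD ?N c x y) - mul_defect mE \<Phi>E FE ?N c (\<psi> x) (\<psi> y)
      = mE c (\<psi> x) (hom_defect \<psi> \<Phi>D \<Phi>E \<Psi> ?N y) - hom_defect \<psi> \<Phi>D \<Phi>E \<Psi> ?N (mD c x y)
        + mE c (hom_defect \<psi> \<Phi>D \<Phi>E \<Psi> ?N x) (\<psi> y)" for c x y
      by (rule hom_defect_cocycle[where mD=mD and mE=mE and FD=FD and FE=FE,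
            OF dom.biadditive_mul cod.biadditive_mul add_\<psi> hom_mul addD \<Phi>D(2) addE \<Phi>E(2)
            FD(1) \<Psi>(1) dialgebra_hom.hom_mul[OF \<Psi>(3)] low])
  qed blast
  \<comment> \<open>Adding \<chi> at order \<open>Suc n\<close> subtracts from each defect exactly
    the coboundary it equals.\<close>
  define \<Phi>D' where "\<Phi>D' = \<Phi>D(?N := \<lambda>x. \<Phi>D ?N x + \<chi>D x)"
  define \<Phi>E' where "\<Phi>E' = \<Phi>E(?N := \<lambda>x. \<Phi>E ?N x + \<chi>E x)"
  have "mul_defect mD \<Phi>D' FD ?N = (\<lambda>c a b. 0)"
  proof (intro ext)
    show "mul_defect mD \<Phi>D' FD ?N c a b = 0" for c a b
      unfolding \<Phi>D'_def mul_defect_update[where m=mD and \<Phi>=\<Phi>D and F=FD,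
          OF dom.biadditive_mul \<Phi>D(2) FD(1) zero_less_Suc]
      by (simp add: \<chi>(3) coboundary_def biadditiveD[OF dom.biadditive_mul])
  qed
  moreover have "mul_defect mE \<Phi>E' FE ?N = (\<lambda>c a b. 0)"
  proof (intro ext)
    show "mul_defect mE \<Phi>E' FE ?N c a b = 0" for c a b
      unfolding \<Phi>E'_def mul_defect_update[where m=mE and \<Phi>=\<Phi>E and F=FE,
          OF cod.biadditive_mul \<Phi>E(2) FE(1) zero_less_Suc]
      by (simp add: \<chi>(4) coboundary_def biadditiveD[OF cod.biadditive_mul])
  qed
  moreover have "hom_defect \<psi> \<Phi>D' \<Phi>E' \<Psi> ?N = (\<lambda>a. 0)"
  proof
    show "hom_defect \<psi> \<Phi>D' \<Phi>E' \<Psi> ?N a = 0" for a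
      unfolding \<Phi>D'_def \<Phi>E'_def hom_defect_update[where \<psi>=\<psi> and \<Psi>=\<Psi>, OF add_\<psi> \<Psi>(1)]
      by (simp add: \<chi>(5))
  qed
  moreover have agree: "\<Phi>D' k = \<Phi>D k" "\<Phi>E' k = \<Phi>E k" if "k \<le> n" for k
    using that by (auto simp: \<Phi>D'_def \<Phi>E'_def)
  moreover have "mul_defect mD \<Phi>D' FD k = (\<lambda>c a b. 0) \<and> mul_defect mE \<Phi>E' FE k = (\<lambda>c a b. 0) \<and>
      hom_defect \<psi> \<Phi>D' \<Phi>E' \<Psi> k = (\<lambda>a. 0)" if "k \<le> n" for k
    using low[of k] agree that mul_defect_cong[of k \<Phi>D' \<Phi>D] mul_defect_cong[of k \<Phi>E' \<Phi>E]
      hom_defect_cong[of k \<Phi>D' \<Phi>D \<Phi>E' \<Phi>E] by simp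
  moreover have "Vector_Spaces.linear sD sD (\<Phi>D' k)" "Vector_Spaces.linear sE sE (\<Phi>E' k)" for k
    using linear_add[OF \<Phi>D(1) \<chi>(1)] linear_add[OF \<Phi>E(1) \<chi>(2)] \<Phi>D(1) \<Phi>E(1)
    by (auto simp: \<Phi>D'_def \<Phi>E'_def)
  ultimately show thesis
    using \<Phi>D(2) \<Phi>E(2) by (intro that[of \<Phi>D' \<Phi>E']) (auto simp: trivializes_upto_def le_Suc_eq)
qed

lemma trivial_HY2_imp_rigid:
  assumes "trivial_group (HY2 sD mD sE mE \<psi>)"
  shows "rigid sD mD sE mE \<psi>"
  unfolding rigid_def
proof (intro allI impI)
  fix \<Theta> assume "morphism_deformation sD mD sE mE \<psi> \<Theta>"
  moreover obtain FD FE \<Psi> where \<Theta>: "\<Theta> = (FD, FE, \<Psi>)" by (rule prod_cases3)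
  ultimately have def: "morphism_deformation sD mD sE mE \<psi> (FD, FE, \<Psi>)" by simp
  define agree :: "nat \<Rightarrow> (nat \<Rightarrow> 'd \<Rightarrow> 'd) \<times> (nat \<Rightarrow> 'e \<Rightarrow> 'e) \<Rightarrow> _ \<Rightarrow> bool" where
    "agree = (\<lambda>n (\<Phi>D, \<Phi>E) (\<Phi>D', \<Phi>E'). \<forall>k\<le>n. \<Phi>D' k = \<Phi>D k \<and> \<Phi>E' k = \<Phi>E k)"
  have "\<exists>p. trivializes_upto \<Theta> 0 p"
    unfolding \<Theta> using trivializes_upto_0[OF def] by blast
  moreover have "\<exists>q. trivializes_upto \<Theta> (Suc n) q \<and> agree n p q" if "trivializes_upto \<Theta> n p" for n p
    using that trivializes_upto_Suc[OF def assms] unfolding \<Theta> agree_def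
    by (cases p) (smt (verit, best) case_prod_conv)
  ultimately obtain p where p: "\<And>n. trivializes_upto \<Theta> n (p n)" "\<And>n. agree n (p n) (p (Suc n))"
    using dependent_nat_choice[of "trivializes_upto \<Theta>" agree] by metis
  \<comment> \<open>The limit is the diagonal: coefficient \<open>n\<close> is final from
    approximation \<open>n\<close> on.\<close>
  define \<Phi>D where "\<Phi>D n = fst (p n) n" for n
  define \<Phi>E where "\<Phi>E n = snd (p n) n" for n
  have eq: "fst (p n) k = \<Phi>D k \<and> snd (p n) k = \<Phi>E k" if "k \<le> n" for k n
    using that
  proof (induction n rule: dec_induct)
    case (step n)
    then show ?case using p(2)[of n] by (auto simp: agree_def case_prod_unfold)
  qed (simp add: \<Phi>D_def \<Phi>E_def)
  have triv: "trivializes_upto (FD, FE, \<Psi>) n (fst (p n), snd (p n))" for n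
    using p(1) \<Theta> by simp
  have lin: "Vector_Spaces.linear sD sD (\<Phi>D n)" "Vector_Spaces.linear sE sE (\<Phi>E n)" for n
    using triv[of n] by (auto simp: trivializes_upto_def \<Phi>D_def \<Phi>E_def)
  have id: "\<Phi>D 0 = id" "\<Phi>E 0 = id"
    using triv[of 0] by (auto simp: trivializes_upto_def \<Phi>D_def \<Phi>E_def)
  \<comment> \<open>Order \<open>n\<close> involves coefficients up to \<open>n\<close> only, where
    the limit agrees with \<open>p n\<close>.\<close>
  have "mul_defect mD \<Phi>D FD n = mul_defect mD (fst (p n)) FD n"
    "mul_defect mE \<Phi>E FE n = mul_defect mE (snd (p n)) FE n"
    "hom_defect \<psi> \<Phi>D \<Phi>E \<Psi> n = hom_defect \<psi> (fst (p n)) (snd (p n)) \<Psi> n" for n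
    using eq by (auto intro!: mul_defect_cong hom_defect_cong)
  then have zero: "mul_defect mD \<Phi>D FD n = (\<lambda>c a b. 0)" "mul_defect mE \<Phi>E FE n = (\<lambda>c a b. 0)"
    "hom_defect \<psi> \<Phi>D \<Phi>E \<Psi> n = (\<lambda>a. 0)" for n
    using triv[of n] by (auto simp: trivializes_upto_def)
  have "fps_apply (constant_series \<psi>) = fps_apply \<Phi>E \<circ> fps_apply \<Psi> \<circ> fps_apply_inv \<Phi>D"
  proof
    fix x
    have "fps_apply \<Phi>D (fps_apply_inv \<Phi>D x) = x"
      using id(1) by (rule fps_apply_fps_apply_inv)
    moreover have "fps_apply (hom_defect \<psi> \<Phi>D \<Phi>E \<Psi>) y = 0" for y
      by (rule fps_ext) (simp add: fps_apply_nth zero)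
    moreover have "additive \<psi>" by (rule linear_imp_additive) unfold_locales
    ultimately show "fps_apply (constant_series \<psi>) x = (fps_apply \<Phi>E \<circ> fps_apply \<Psi> \<circ> fps_apply_inv \<Phi>D) x"
      \<comment> \<open>With zero defect,
        \<open>\<Phi>\<^sub>E \<Psi>\<^sub>t = \<psi> \<Phi>\<^sub>D\<close>; evaluation at the
        preimage of \<open>x\<close> under \<open>\<Phi>\<^sub>D\<close> gives the claim.\<close>
      using fps_apply_hom_defect[where \<psi>=\<psi> and \<Psi>=\<Psi> and \<Phi>D=\<Phi>D and \<Phi>E=\<Phi>E and x="fps_apply_inv \<Phi>D x"]
        linear_imp_additive[OF lin(2)] by simp
  qed
  moreover have "formal_iso sD FD (constant_series mD) \<Phi>D" "formal_iso sE FE (constant_series mE) \<Phi>E"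
    by (auto intro!: formal_iso_constant_series lin id zero dom.biadditive_mul cod.biadditive_mul)
  ultimately have "morphism_formal_iso sD sE \<Theta> (trivial_deformation mD mE \<psi>) (\<Phi>D, \<Phi>E)"
    unfolding \<Theta> trivial_deformation_eq by simp
  then show "equivalent_deformations sD sE \<Theta> (trivial_deformation mD mE \<psi>)"
    unfolding equivalent_deformations_def by blast
qed

end

theorem corollary5p8:
  fixes sD :: "'k::field \<Rightarrow> 'd::ab_group_add \<Rightarrow> 'd"
    and mD :: "prodsort \<Rightarrow> 'd \<Rightarrow> 'd \<Rightarrow> 'd"
    and sE :: "'k \<Rightarrow> 'e::ab_group_add \<Rightarrow> 'e"
    and mE :: "prodsort \<Rightarrow> 'e \<Rightarrow> 'e \<Rightarrow> 'e"
    and \<psi> :: "'d \<Rightarrow> 'e"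
  assumes "dialgebra_hom sD mD sE mE \<psi>"
    and "trivial_group (HY2 sD mD sE mE \<psi>)"
  shows "rigid sD mD sE mE \<psi>"
  using dialgebra_hom.trivial_HY2_imp_rigid[OF assms] .

end
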